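(* Let $F$ be a finite field of characteristic $p$ with $|F|=q=p^k$ and let $G=C_2 \times A_4$. (1) If $p=3$, then $$U(FG) \cong C_3^{4k} \rtimes \left(C_{3^k-1}^2 \times GL(3, F)^2\right)$$ (for some action defining the semidirect product). (2) If $p>3$, then $$U(FG) \cong \begin{cases} C_{p^k-1}^{6} \times GL(3,F)^2, & \text{if } q \equiv 1 \bmod 6;\\ C_{p^k-1}^2 \times C_{p^{2k}-1}^2 \times GL(3, F)^2, & \text{if } q \equiv -1 \bmod 6.\end{cases}$$
   Context: $FG$ denotes the group algebra of a finite group $G$ over $F$, and $U(FG)$ its group of units. $C_n$ is the cyclic group of order $n$, $A_4$ is the alternating group on four letters, and $H^m$ denotes the direct product of $m$ copies of a group $H$. $N \rtimes H$ denotes a semidirect product with normal factor $N$. *)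

theory Defs
  imports
    "HOL-Algebra.Algebra"
    "HOL-Number_Theory.Cong"
    "HOL-Library.Cardinality"
    "Jordan_Normal_Form.Matrix"
begin

text \<open>
  The group algebra of a finite group \<open>G\<close> over the coefficient type \<open>'a\<close>. The element
  \<open>\<Sum>\<^sub>g a\<^sub>g g\<close> is represented by its coefficient function \<open>g \<mapsto> a\<^sub>g\<close>, which is \<open>0\<close> outside
  \<open>carrier G\<close>. There is no finite-support condition, so this is the group algebra
  only if \<open>carrier G\<close> is finite. The product is convolution: the coefficient of \<open>f g\<close> at
  \<open>x\<close> is the sum of \<open>f(y) g(z)\<close> over all \<open>y, z\<close> with \<open>y z = x\<close>.
\<close>

definition group_algebra ::
    "'a::comm_ring_1 itself \<Rightarrow> ('g, 'b) monoid_scheme \<Rightarrow> ('g \<Rightarrow> 'a) ring" where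
  "group_algebra ty G =
    \<lparr>carrier = {f. \<forall>x. x \<notin> carrier G \<longrightarrow> f x = 0},
     monoid.mult = (\<lambda>f g x. if x \<in> carrier G
                            then (\<Sum>y\<in>carrier G. f y * g (inv\<^bsub>G\<^esub> y \<otimes>\<^bsub>G\<^esub> x)) else 0),
     one = (\<lambda>x. if x = \<one>\<^bsub>G\<^esub> then 1 else 0),
     ring.zero = (\<lambda>x. 0),
     ring.add = (\<lambda>f g x. f x + g x)\<rparr>"

definition GL :: "nat \<Rightarrow> 'a::field itself \<Rightarrow> 'a mat monoid" where
  "GL n ty = units_of (ring_mat ty n ())"

definition group_power :: "('a, 'b) monoid_scheme \<Rightarrow> nat \<Rightarrow> (nat \<Rightarrow> 'a) monoid" where
  "group_power H m = product_group {..<m} (\<lambda>_. H)"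

text \<open>
  The (outer) semidirect product of \<open>N\<close> (the normal factor) and \<open>H\<close>. It is meant to be used
  with an action \<open>\<phi> \<in> hom H (AutoGroup N)\<close> of \<open>H\<close> on \<open>N\<close> by group automorphisms.
\<close>

definition semidirect_product ::
    "('n, 'b) monoid_scheme \<Rightarrow> ('h, 'c) monoid_scheme \<Rightarrow> ('h \<Rightarrow> 'n \<Rightarrow> 'n) \<Rightarrow> ('n \<times> 'h) monoid"
  where
  "semidirect_product N H \<phi> =
    \<lparr>carrier = carrier N \<times> carrier H,
     monoid.mult = (\<lambda>(n, h) (n', h'). (n \<otimes>\<^bsub>N\<^esub> \<phi> h n', h \<otimes>\<^bsub>H\<^esub> h')),
     one = (\<one>\<^bsub>N\<^esub>, \<one>\<^bsub>H\<^esub>)\<rparr>"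

end

theory Submission
  imports Defs
begin

text \<open>
  \<open>G = C\<^sub>2 \<times> A\<^sub>4\<close> is the semidirect product of \<open>C\<^sub>2\<^sup>3\<close> by \<open>C\<^sub>3\<close>. The four representations of \<open>G\<close> induced
  from representatives of the \<open>C\<^sub>3\<close>-orbits of characters of \<open>C\<^sub>2\<^sup>3\<close> map \<open>FG\<close> to 3-by-3 matrices: for the
  two characters that are trivial on the Klein four-group the matrices are circulant and form a copy
  of \<open>F[C\<^sub>3]\<close>. On each coset of \<open>C\<^sub>2\<^sup>3\<close> the entries of these matrices are the Hadamard transform of the
  coefficients, so in odd characteristic \<open>FG\<close> is isomorphic to \<open>F[C\<^sub>3]\<^sup>2 \<times> M\<^sub>3(F)\<^sup>2\<close>.

  Finally, \<open>F[C\<^sub>3] = F[x]/(x\<^sup>3 - 1)\<close> is \<open>F\<^sup>3\<close> if \<open>F\<close> contains a primitive cube root of unity, \<open>F \<times> F(w)\<close>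
  with \<open>F(w)\<close> quadratic if it does not, and \<open>F[y]/(y\<^sup>3)\<close> in characteristic 3. In the last case the units
  with constant term 1 form an elementary abelian 3-group, and the action in the semidirect product is
  trivial.
\<close>

section \<open>Isomorphisms of products and unit groups\<close>

lemma DirProd_is_iso_cong:
  assumes "G \<cong> G'" "H \<cong> H'"
  shows "G \<times>\<times> H \<cong> G' \<times>\<times> H'"
proof -
  obtain g h where "g \<in> iso G G'" "h \<in> iso H H'"
    using assms by (auto simp: is_iso_def)
  then have "map_prod g h \<in> iso (G \<times>\<times> H) (G' \<times>\<times> H')"
    by (auto simp: iso_def hom_def Pi_iff bij_betw_map_prod)
  then show ?thesis by (rule is_isoI)
qed

lemma DirProd_swap_middle_iso:
  "(A \<times>\<times> B) \<times>\<times> (C \<times>\<times> D) \<cong> (A \<times>\<times> C) \<times>\<times> (B \<times>\<times> D)"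
proof -
  have "(\<lambda>((a, b), (c, d)). ((a, c), (b, d))) \<in> iso ((A \<times>\<times> B) \<times>\<times> (C \<times>\<times> D)) ((A \<times>\<times> C) \<times>\<times> (B \<times>\<times> D))"
    by (auto simp: iso_def hom_def bij_betw_def inj_on_def image_iff)
  then show ?thesis by (rule is_isoI)
qed

section \<open>Powers of a group and their concatenation\<close>

lemma carrier_group_power:
  "carrier (group_power H n) = {f. (\<forall>i<n. f i \<in> carrier H) \<and> (\<forall>i\<ge>n. f i = undefined)}"
  by (auto simp: group_power_def PiE_def extensional_def)

lemma mult_group_power:
  "f \<otimes>\<^bsub>group_power H n\<^esub> g = (\<lambda>i. if i < n then f i \<otimes>\<^bsub>H\<^esub> g i else undefined)"
  by (simp add: group_power_def restrict_def)

lemma DirProd_assoc_is_iso: "(G \<times>\<times> H) \<times>\<times> I \<cong> G \<times>\<times> H \<times>\<times> I"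
proof -
  have "(\<lambda>((x, y), z). (x, y, z)) \<in> iso ((G \<times>\<times> H) \<times>\<times> I) (G \<times>\<times> H \<times>\<times> I)"
    by (auto simp: iso_def hom_def bij_betw_def inj_on_def image_iff)
  then show ?thesis by (rule is_isoI)
qed

lemma group_power_1_iso: "H \<cong> group_power H 1"
proof -
  have "bij_betw (\<lambda>h i. if i < 1 then h else undefined) (carrier H) (carrier (group_power H 1))"
    by (rule bij_betw_byWitness[where f' = "\<lambda>f. f 0"]) (auto simp: carrier_group_power fun_eq_iff)
  then have "(\<lambda>h i. if i < 1 then h else undefined) \<in> iso H (group_power H 1)"
    by (simp add: iso_def hom_def carrier_group_power mult_group_power fun_eq_iff)
  then show ?thesis by (rule is_isoI)
qed

lemma group_power_add_iso:
  "group_power H m \<times>\<times> group_power H n \<cong> group_power H (m + n)"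
proof -
  let ?h = "\<lambda>(f, g) i. if i < m then f i else if i < m + n then g (i - m) else undefined"
  let ?k = "\<lambda>f. (\<lambda>i. if i < m then f i else undefined, \<lambda>i. if i < n then f (m + i) else undefined)"
  have "bij_betw ?h (carrier (group_power H m \<times>\<times> group_power H n)) (carrier (group_power H (m + n)))"
    by (rule bij_betw_byWitness[where f' = ?k]) (auto simp: carrier_group_power fun_eq_iff)
  moreover have "?h \<in> hom (group_power H m \<times>\<times> group_power H n) (group_power H (m + n))"
    by (rule homI) (auto simp: carrier_group_power mult_group_power fun_eq_iff)
  ultimately have "?h \<in> iso (group_power H m \<times>\<times> group_power H n) (group_power H (m + n))"
    by (simp add: iso_def)
  then show ?thesis by (rule is_isoI)
qed

lemma group_power_2_iso: "H \<times>\<times> H \<cong> group_power H 2"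
proof -
  have "H \<times>\<times> H \<cong> group_power H 1 \<times>\<times> group_power H 1"
    by (intro DirProd_is_iso_cong group_power_1_iso)
  also have "\<dots> \<cong> group_power H (1 + 1)" by (rule group_power_add_iso)
  finally show ?thesis by (simp add: numeral_2_eq_2)
qed

lemma group_power_6_iso: "(H \<times>\<times> H \<times>\<times> H) \<times>\<times> (H \<times>\<times> H \<times>\<times> H) \<cong> group_power H 6"
proof -
  have "H \<times>\<times> H \<times>\<times> H \<cong> group_power H 1 \<times>\<times> group_power H 2"
    by (intro DirProd_is_iso_cong group_power_1_iso group_power_2_iso)
  also have "\<dots> \<cong> group_power H (1 + 2)" by (rule group_power_add_iso)
  finally have "H \<times>\<times> H \<times>\<times> H \<cong> group_power H 3" by (simp add: numeral_eq_Suc)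
  then have "(H \<times>\<times> H \<times>\<times> H) \<times>\<times> (H \<times>\<times> H \<times>\<times> H) \<cong> group_power H 3 \<times>\<times> group_power H 3"
    by (intro DirProd_is_iso_cong)
  also have "\<dots> \<cong> group_power H (3 + 3)" by (rule group_power_add_iso)
  finally show ?thesis by simp
qed

section \<open>Unit groups of products and of isomorphic structures\<close>

lemma units_of_DirProd: "units_of (G \<times>\<times> H) = units_of G \<times>\<times> units_of H"
proof -
  have "Units (G \<times>\<times> H) = Units G \<times> Units H"
    by (auto simp: Units_def) blast
  then show ?thesis by (simp add: units_of_def DirProd_def)
qed

text \<open>Closure of R allows \<open>h (y x) = h 1\<close> to be cancelled to
  \<open>y x = 1\<close>, so inverses in S pull back along the bijection. Working with
  multiplication alone lets the lemma serve group algebras, matrix rings and bare monoids of triples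
  alike.\<close>

lemma units_of_iso:
  assumes h: "h \<in> iso R S" and one: "h \<one>\<^bsub>R\<^esub> = \<one>\<^bsub>S\<^esub>" and oneR: "\<one>\<^bsub>R\<^esub> \<in> carrier R"
  assumes closed: "\<And>x y. x \<in> carrier R \<Longrightarrow> y \<in> carrier R \<Longrightarrow> x \<otimes>\<^bsub>R\<^esub> y \<in> carrier R"
  shows "units_of R \<cong> units_of S"
proof -
  have hom: "h (x \<otimes>\<^bsub>R\<^esub> y) = h x \<otimes>\<^bsub>S\<^esub> h y" if "x \<in> carrier R" "y \<in> carrier R" for x y
    using h that by (auto simp: iso_def hom_def)
  have bij: "bij_betw h (carrier R) (carrier S)" using h by (simp add: iso_def)
  have eq: "h x = h y \<longleftrightarrow> x = y" if "x \<in> carrier R" "y \<in> carrier R" for x y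
    using bij that by (meson bij_betw_def inj_on_eq_iff)
  have unit_iff: "h x \<in> Units S \<longleftrightarrow> x \<in> Units R" if x: "x \<in> carrier R" for x
  proof -
    have "h x \<in> Units S \<longleftrightarrow> (\<exists>y \<in> carrier R. h y \<otimes>\<^bsub>S\<^esub> h x = \<one>\<^bsub>S\<^esub> \<and> h x \<otimes>\<^bsub>S\<^esub> h y = \<one>\<^bsub>S\<^esub>)"
      using bij x by (auto simp: Units_def bij_betw_def image_iff) (metis imageE)+
    also have "\<dots> \<longleftrightarrow> x \<in> Units R"
      using x oneR closed by (auto simp: Units_def hom[symmetric] one[symmetric] eq)
    finally show ?thesis .
  qed
  have "h ` Units R = Units S"
  proof
    show "h ` Units R \<subseteq> Units S" using unit_iff by (auto simp: Units_def)
    show "Units S \<subseteq> h ` Units R"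
    proof
      fix s assume s: "s \<in> Units S"
      then have "s \<in> carrier S" by (simp add: Units_def)
      then obtain x where "x \<in> carrier R" "s = h x" using bij by (auto simp: bij_betw_def)
      then show "s \<in> h ` Units R" using s unit_iff by blast
    qed
  qed
  moreover have sub: "Units R \<subseteq> carrier R" by (auto simp: Units_def)
  ultimately have "h \<in> iso (units_of R) (units_of S)"
    using bij hom by (auto simp: iso_def hom_def units_of_def bij_betw_def subsetD intro: inj_on_subset)
  then show ?thesis by (rule is_isoI)
qed

text \<open>The identity is written as a restricted function because members of
  \<open>AutoGroup N\<close> are extensional on \<open>carrier N\<close>.\<close>

lemma semidirect_product_trivial_iso:
  "N \<times>\<times> H \<cong> semidirect_product N H (\<lambda>_. \<lambda>x\<in>carrier N. x)"
proof -
  have "(\<lambda>x. x) \<in> iso (N \<times>\<times> H) (semidirect_product N H (\<lambda>_. \<lambda>x\<in>carrier N. x))"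
    by (auto simp: iso_def hom_def semidirect_product_def bij_betw_def)
  then show ?thesis by (rule is_isoI)
qed

lemma trivial_action_hom:
  assumes "group N"
  shows "(\<lambda>_. \<lambda>x\<in>carrier N. x) \<in> hom H (AutoGroup N)"
proof -
  have "(\<lambda>x\<in>carrier N. x) \<in> auto N" using assms by (rule group.id_in_auto)
  moreover have "(\<lambda>x\<in>carrier N. x) \<otimes>\<^bsub>AutoGroup N\<^esub> (\<lambda>x\<in>carrier N. x) = (\<lambda>x\<in>carrier N. x)"
    by (auto simp: AutoGroup_def BijGroup_def id_Bij compose_def)
  ultimately show ?thesis by (auto simp: hom_def AutoGroup_def)
qed

text \<open>The isomorphism is i -> a^i: two exponents give the same power iff they agree modulo the
  order of a, which for a generator is the group order. Surjectivity follows by counting.\<close>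

lemma (in group) cyclic_iso_integer_mod_group:
  assumes a: "a \<in> carrier G" and fin: "finite (carrier G)"
    and gen: "carrier G = {a [^] i | i::nat. True}"
  shows "G \<cong> integer_mod_group (order G)"
proof -
  have ord: "ord a = order G"
  proof -
    have "carrier G = (\<lambda>i. a [^] i) ` {0..ord a - 1}"
      using ord_elems[OF fin a] gen by auto
    then show ?thesis using ord_inj[OF a] fin a
      by (metis card_atLeastAtMost card_image ord_ge_1 order_def Suc_pred' diff_zero less_eq_Suc_le One_nat_def)
  qed
  \<comment> \<open>This excludes modulus 0, for which \<open>integer_mod_group\<close> is the
    infinite group of all integers.\<close>
  have pos: "order G > 0" using fin order_gt_0_iff_finite by blast
  have "(\<lambda>i. a [^] i) \<in> iso (integer_mod_group (order G)) G"
    unfolding iso_def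
  proof (intro CollectI conjI)
    show "(\<lambda>i. a [^] i) \<in> hom (integer_mod_group (order G)) G"
      using a by (auto simp: hom_def int_pow_mult[symmetric] int_pow_eq ord)
    have inj: "inj_on (\<lambda>i::int. a [^] i) (carrier (integer_mod_group (order G)))"
    proof (rule inj_onI)
      fix i j :: int
      assume ij: "i \<in> carrier (integer_mod_group (order G))" "j \<in> carrier (integer_mod_group (order G))"
        and "a [^] i = a [^] j"
      then have "int (order G) dvd (i - j) \<or> int (order G) dvd (j - i)"
        using a by (auto simp: int_pow_eq ord)
      then have "i mod int (order G) = j mod int (order G)"
        by (metis mod_eq_dvd_iff)
      with ij pos show "i = j" by (auto simp: carrier_integer_mod_group)
    qed
    have "(\<lambda>i. a [^] i) ` carrier (integer_mod_group (order G)) = carrier G"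
      by (rule card_subset_eq[OF fin])
         (use a pos card_image[OF inj] in \<open>auto simp: carrier_integer_mod_group order_def\<close>)
    then show "bij_betw (\<lambda>i. a [^] i) (carrier (integer_mod_group (order G))) (carrier G)"
      using inj by (simp add: bij_betw_def)
  qed
  then have "integer_mod_group (order G) \<cong> G" by (rule is_isoI)
  then show ?thesis by (rule group.iso_sym[OF group_integer_mod_group])
qed

text \<open>Finite multiplicative groups of fields are cyclic. The field is a record rather than a
  type so that the result covers both the coefficient field and its quadratic extension.\<close>

lemma (in field) finite_units_iso:
  assumes "finite (carrier R)"
  shows "units_of R \<cong> integer_mod_group (order R - 1)"
proof -
  interpret U: group "units_of R" by (rule units_group)
  obtain a where a: "a \<in> carrier (Multiplicative_Group.mult_of R)" "carrier (Multiplicative_Group.mult_of R) = {a [^] i | i::nat. i \<in> UNIV}"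
    using finite_field_mult_group_has_gen[OF assms] by (rule bexE)
  have pw: "a [^]\<^bsub>units_of R\<^esub> (i::nat) = a [^] i" for i
    using Multiplicative_Group.nat_pow_mult_of[of R] by (simp add: mult_of_is_Units)
  have "units_of R \<cong> integer_mod_group (order (units_of R))"
  proof (rule U.cyclic_iso_integer_mod_group[of a])
    show "a \<in> carrier (units_of R)" using a(1) by (simp add: mult_of_is_Units)
    show "finite (carrier (units_of R))" using finite_mult_of[OF assms] by (simp add: mult_of_is_Units)
    show "carrier (units_of R) = {a [^]\<^bsub>units_of R\<^esub> i | i::nat. True}"
      using a(2) unfolding mult_of_is_Units pw by simp
  qed
  also have "order (units_of R) = order R - 1"
    using order_mult_of[OF assms] by (simp add: mult_of_is_Units)
  finally show ?thesis .
qed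

section \<open>Elementary abelian groups\<close>

text \<open>Such a group is a vector space over the field with p elements, written multiplicatively.
  A maximal independent family spans it, hence is a basis, and counting shows that it has m
  members.\<close>

lemma (in comm_group) elementary_abelian_iso:
  assumes p: "Factorial_Ring.prime p" and exp: "\<And>x. x \<in> carrier G \<Longrightarrow> x [^] p = \<one>"
    and card: "order G = p ^ m"
  shows "G \<cong> group_power (integer_mod_group p) m"
proof -
  have p0: "p > 0" and p1: "p > 1" using p prime_gt_0_nat prime_gt_1_nat by auto
  have fin: "finite (carrier G)" using card p0 order_gt_0_iff_finite by (metis zero_less_power)
  have pow_mod: "x [^] (a mod int p) = x [^] a" if "x \<in> carrier G" for x and a :: int
  proof -
    have "x [^] a = x [^] (int p * (a div int p) + a mod int p)" by simp
    also have "\<dots> = (x [^] p) [^] (a div int p) \<otimes> x [^] (a mod int p)"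
      using that by (simp only: int_pow_mult int_pow_pow[symmetric] int_pow_int)
    finally show ?thesis using that exp by simp
  qed
  \<comment> \<open>\<open>L b n f\<close> is the linear combination of \<open>b 0\<close>, ...,
    \<open>b (n - 1)\<close> with coefficients f. The set \<open>C n\<close> holds the reduced
    coefficient vectors, and \<open>good n\<close> below says that n independent vectors
    exist.\<close>
  define L where "L = (\<lambda>b n f. finprod G (\<lambda>i. b i [^] (f i :: int)) {..<n::nat})"
  define C where "C = (\<lambda>n. carrier (group_power (integer_mod_group p) n))"
  have C: "C n = {f. (\<forall>i<n. 0 \<le> f i \<and> f i < int p) \<and> (\<forall>i\<ge>n. f i = undefined)}" for n
    using p0 by (auto simp: C_def carrier_group_power carrier_integer_mod_group)
  have cardC: "card (C n) = p ^ n" for n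
    using p0 by (simp add: C_def group_power_def card_PiE carrier_integer_mod_group)
  have Lc: "L b n f \<in> carrier G" if "\<And>i. i < n \<Longrightarrow> b i \<in> carrier G" for b n f
    using that by (auto simp: L_def intro!: finprod_closed)
  have Lmult: "L b n f \<otimes> L b n g = L b n (\<lambda>i. f i + g i)" if "\<And>i. i < n \<Longrightarrow> b i \<in> carrier G" for b n f g
  proof -
    have "L b n f \<otimes> L b n g = finprod G (\<lambda>i. b i [^] f i \<otimes> b i [^] g i) {..<n}"
      unfolding L_def using that by (intro finprod_multf[symmetric]) auto
    also have "\<dots> = L b n (\<lambda>i. f i + g i)"
      unfolding L_def using that by (intro finprod_cong') (auto simp: int_pow_mult)
    finally show ?thesis .
  qed
  have Lcong: "L b n f = L b n g"
    if "\<And>i. i < n \<Longrightarrow> b i \<in> carrier G" "\<And>i. i < n \<Longrightarrow> f i mod int p = g i mod int p" for b n f g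
    unfolding L_def using that
    by (intro finprod_cong') (auto, metis pow_mod)
  have Lpow: "L b n f [^] (a::int) = L b n (\<lambda>i. f i * a)" if "\<And>i. i < n \<Longrightarrow> b i \<in> carrier G" for b n f a
  proof -
    have "finprod G (\<lambda>i. b i [^] f i) {..<k} [^] a = finprod G (\<lambda>i. b i [^] (f i * a)) {..<k}"
      if "k \<le> n" for k
      using that
    proof (induction k)
      case (Suc k)
      have k: "b i \<in> carrier G" if "i < Suc k" for i using that Suc.prems \<open>\<And>i. i < n \<Longrightarrow> b i \<in> carrier G\<close> by auto
      show ?case using Suc k
        by (simp add: lessThan_Suc Pi_iff int_pow_distrib int_pow_pow)
    qed simp
    then show ?thesis by (simp add: L_def)
  qed
  define good where "good = (\<lambda>n. \<exists>b. (\<forall>i<n. b i \<in> carrier G) \<and> inj_on (L b n) (C n))"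
  have bound: "n \<le> m" if "good n" for n
  proof -
    obtain b where b: "\<forall>i<n. b i \<in> carrier G" "inj_on (L b n) (C n)" using \<open>good n\<close> by (auto simp: good_def)
    have "card (C n) \<le> card (carrier G)"
      by (rule card_inj_on_le[OF b(2) _ fin]) (use b Lc in blast)
    then have "p ^ n \<le> p ^ m" using cardC card by (simp add: order_def)
    then show ?thesis using p1 by simp
  qed
  have "good 0" by (auto simp: good_def C inj_on_def fun_eq_iff)
  then obtain n where n: "good n" and max: "\<And>k. good k \<Longrightarrow> k \<le> n"
    using bound by (metis Greatest_le_nat GreatestI_nat)
  obtain b where b: "\<And>i. i < n \<Longrightarrow> b i \<in> carrier G" and inj: "inj_on (L b n) (C n)"
    using n by (auto simp: good_def)
  have norm: "L b n f \<in> L b n ` C n" for f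
  proof -
    define g where "g = (\<lambda>i. if i < n then f i mod int p else undefined)"
    have "g \<in> C n" using p0 by (auto simp: C g_def)
    moreover have "L b n f = L b n g" by (rule Lcong[OF b]) (auto simp: g_def)
    ultimately show ?thesis by blast
  qed
  have surj: "L b n ` C n = carrier G"
  proof (rule ccontr)
    assume "L b n ` C n \<noteq> carrier G"
    \<comment> \<open>an element outside the span of a maximal independent family would extend it\<close>
    then obtain x where x: "x \<in> carrier G" "x \<notin> L b n ` C n" using Lc b by blast
    \<comment> \<open>If x^a lay in the span with a prime to p, raising it to an inverse of a modulo
      p would put x itself in the span.\<close>
    have notin: "x [^] (a::int) \<noteq> L b n f" if a: "\<not> int p dvd a" for a f
    proof
      assume *: "x [^] a = L b n f"
      have "coprime a (int p)" using p a
        by (metis coprime_commute prime_imp_coprime prime_int_nat_transfer prime_nat_int_transfer of_nat_0_le_iff)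
      then obtain c where c: "[a * c = 1] (mod int p)" by (metis cong_solve_coprime_int)
      have "x = x [^] (1::int)" using x by simp
      also have "\<dots> = x [^] (1 mod int p)" by (simp only: pow_mod[OF x(1)])
      also have "\<dots> = x [^] ((a * c) mod int p)" using c by (simp add: cong_def)
      also have "\<dots> = (x [^] a) [^] c" using x by (simp only: pow_mod[OF x(1)] int_pow_pow)
      also have "\<dots> = L b n (\<lambda>i. f i * c)" unfolding * by (rule Lpow[OF b])
      finally show False using x(2) norm by metis
    qed
    define b' where "b' = b(n := x)"
    have b': "b' i \<in> carrier G" if "i < Suc n" for i using that b x by (auto simp: b'_def less_Suc_eq)
    have L': "L b' (Suc n) f = x [^] f n \<otimes> L b n f" for f
    proof -
      have "L b' (Suc n) f = b' n [^] f n \<otimes> finprod G (\<lambda>i. b' i [^] f i) {..<n}"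
        unfolding L_def lessThan_Suc using b' by (subst finprod_insert) auto
      also have "finprod G (\<lambda>i. b' i [^] f i) {..<n} = L b n f"
        unfolding L_def using b by (intro finprod_cong') (auto simp: b'_def)
      also have "b' n = x" by (simp add: b'_def)
      finally show ?thesis .
    qed
    have "inj_on (L b' (Suc n)) (C (Suc n))"
    proof (rule inj_onI)
      fix f g assume f: "f \<in> C (Suc n)" and g: "g \<in> C (Suc n)" and eq: "L b' (Suc n) f = L b' (Suc n) g"
      have eq': "x [^] f n \<otimes> L b n f = x [^] g n \<otimes> L b n g" using eq by (simp add: L')
      \<comment> \<open>The power of x by the difference of the last coefficients lies in the span
        of b, so p divides this difference. Both coefficients are reduced, hence equal.\<close>
      have "x [^] (f n - g n) = x [^] f n \<otimes> inv (x [^] g n)" using x by (simp add: int_pow_diff)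
      also have "\<dots> = L b n g \<otimes> inv (L b n f)"
      proof -
        note cl = int_pow_closed[OF x(1), of "f n"] int_pow_closed[OF x(1), of "g n"]
          Lc[of n b f, OF b] Lc[of n b g, OF b]
        have "L b n g = inv (x [^] g n) \<otimes> (x [^] f n \<otimes> L b n f)"
          unfolding eq' using cl by (simp add: m_assoc[symmetric])
        then have "L b n g \<otimes> inv (L b n f) = inv (x [^] g n) \<otimes> x [^] f n"
          using cl by (simp add: m_assoc)
        then show ?thesis using cl by (simp add: m_comm)
      qed
      also have "\<dots> = L b n g \<otimes> L b n (\<lambda>i. f i * - 1)"
        using Lpow[of n b f "- 1", OF b] Lc[of n b f, OF b] by (simp add: int_pow_neg)
      also have "\<dots> = L b n (\<lambda>i. g i + f i * - 1)" by (rule Lmult[OF b])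
      finally have "int p dvd f n - g n" using notin[of "f n - g n"] by (auto simp del: mult_minus1_right)
      moreover have "0 \<le> f n" "f n < int p" "0 \<le> g n" "g n < int p" using f g by (auto simp: C)
      ultimately have fgn: "f n = g n" by (metis mod_eq_dvd_iff mod_pos_pos_trivial)
      have "L b n f = L b n g" using eq' x Lc[of n b f, OF b] Lc[of n b g, OF b] by (simp add: fgn)
      \<comment> \<open>Truncation to the first n coefficients, so that the injectivity of
        \<open>L b n\<close> on \<open>C n\<close> applies.\<close>
      define r where "r = (\<lambda>h i. if i < n then h i else undefined :: int)"
      have "L b n (r f) = L b n f" "L b n (r g) = L b n g"
        by (rule Lcong[OF b]; simp add: r_def)+
      moreover have "r f \<in> C n" "r g \<in> C n" using f g by (auto simp: C r_def)
      ultimately have "r f = r g" using inj \<open>L b n f = L b n g\<close> by (metis inj_onD)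
      then have "f i = g i" if "i < n" for i using that by (metis r_def)
      with fgn f g show "f = g" by (auto simp: C fun_eq_iff) (metis less_antisym linorder_not_less)
    qed
    then have "good (Suc n)" using b' by (auto simp: good_def)
    then show False using max by fastforce
  qed
  have "card (C n) = card (carrier G)" using surj inj by (metis card_image)
  then have nm: "n = m" using cardC card p1 by (simp add: order_def)
  have "L b n \<in> iso (group_power (integer_mod_group p) n) G"
    unfolding iso_def
  proof (intro CollectI conjI)
    show "bij_betw (L b n) (carrier (group_power (integer_mod_group p) n)) (carrier G)"
      using inj surj by (simp add: bij_betw_def C_def)
    show "L b n \<in> hom (group_power (integer_mod_group p) n) G"
    proof (rule homI)
      fix f g
      show "L b n (f \<otimes>\<^bsub>group_power (integer_mod_group p) n\<^esub> g) = L b n f \<otimes> L b n g"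
      proof -
        have "L b n (f \<otimes>\<^bsub>group_power (integer_mod_group p) n\<^esub> g) = L b n (\<lambda>i. f i + g i)"
          by (rule Lcong[OF b]) (simp_all add: mult_group_power)
        also have "\<dots> = L b n f \<otimes> L b n g" by (rule Lmult[OF b, symmetric])
        finally show ?thesis .
      qed
    qed (rule Lc[OF b])
  qed
  then have "group_power (integer_mod_group p) m \<cong> G" using nm by (auto intro: is_isoI)
  moreover have "group (group_power (integer_mod_group p) m)"
    by (simp add: group_power_def)
  ultimately show ?thesis by (metis group.iso_sym)
qed

section \<open>Affine coordinates on \<open>C\<^sub>2 \<times> A\<^sub>4\<close>\<close>

text \<open>
  The points \<open>1, \<dots>, 4\<close> are identified with the vectors of \<open>{0,1}\<^sup>2\<close>, the plane over the field with two elements.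
  With \<open>act c\<close> the \<open>c\<close>-th power of a linear map of order three, \<open>A\<^sub>4\<close> becomes the group of affine
  maps \<open>x \<mapsto> v + act c x\<close>.
\<close>

fun enc :: "nat \<Rightarrow> bool \<times> bool" where
  "enc x = (x = 2 \<or> x = 4, x = 3 \<or> x = 4)"

fun dec :: "bool \<times> bool \<Rightarrow> nat" where
  "dec (a, b) = 1 + of_bool a + 2 * of_bool b"

text \<open>On booleans \<open>\<noteq>\<close> is addition modulo 2: the order-three map sends (a,
  b) to (b, a + b), and its square sends (a, b) to (a + b, a).\<close>

fun act :: "nat \<Rightarrow> bool \<times> bool \<Rightarrow> bool \<times> bool" where
  "act c (a, b) = (if c = 0 then (a, b) else if c = 1 then (b, a \<noteq> b) else (a \<noteq> b, a))"

fun add2 :: "bool \<times> bool \<Rightarrow> bool \<times> bool \<Rightarrow> bool \<times> bool" where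
  "add2 (a, b) (a', b') = (a \<noteq> a', b \<noteq> b')"

definition alt4 :: "(bool \<times> bool) \<Rightarrow> nat \<Rightarrow> nat \<Rightarrow> nat" where
  "alt4 v c = (\<lambda>x. if x \<in> {1..4} then dec (add2 v (act c (enc x))) else x)"

lemma less_3_cases: "c < 3 \<longleftrightarrow> c = 0 \<or> c = 1 \<or> c = (2 :: nat)"
  by auto

lemma enc_dec [simp]: "enc (dec v) = v"
  by (cases v) auto

lemma dec_enc: "x \<in> {1..4} \<Longrightarrow> dec (enc x) = x"
  by (auto simp: atLeastAtMost_iff le_Suc_eq numeral_eq_Suc)

lemma dec_range [simp]: "Suc 0 \<le> dec v" "dec v \<le> 4"
  by (cases v, simp)+

lemma add2_assoc: "add2 (add2 u v) w = add2 u (add2 v w)"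
  by (cases u; cases v; cases w) auto

lemma add2_self [simp]: "add2 v v = (False, False)" "add2 (False, False) v = v" "add2 v (False, False) = v"
  by (cases v; auto)+

lemma act_add2: "act c (add2 u v) = add2 (act c u) (act c v)"
  by (cases u; cases v) auto

lemma act_zero [simp]: "act c (False, False) = (False, False)"
  by simp

lemma act_act: "c < 3 \<Longrightarrow> c' < 3 \<Longrightarrow> act c (act c' v) = act ((c + c') mod 3) v"
  by (cases v) (auto simp: less_3_cases)

lemma alt4_comp:
  assumes "c < 3" "c' < 3"
  shows "alt4 v c \<circ> alt4 v' c' = alt4 (add2 v (act c v')) ((c + c') mod 3)"
proof
  fix x
  show "(alt4 v c \<circ> alt4 v' c') x = alt4 (add2 v (act c v')) ((c + c') mod 3) x"
    using assms by (simp add: alt4_def act_add2 act_act add2_assoc del: enc.simps dec.simps act.simps add2.simps)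
qed

lemma alt4_id: "alt4 (False, False) 0 = id"
  by (auto simp: alt4_def fun_eq_iff dec_enc prod_eq_iff simp del: enc.simps)
     (metis act.simps add2_self(2) atLeastAtMost_iff dec_enc One_nat_def prod.collapse)

lemma alt4_permutes: assumes "c < 3" shows "alt4 v c permutes {1..4}"
proof (rule bij_imp_permutes)
  \<comment> \<open>With g the linear part and v = -v, the inverse of x -> v + g x is x -> g^-1 v +
    g^-1 x. The outer \<open>mod 3\<close> turns the exponent 3 into 0 when c = 0.\<close>
  have "alt4 (act ((3 - c) mod 3) v) ((3 - c) mod 3) \<circ> alt4 v c = id"
    using assms by (subst alt4_comp) (auto simp: alt4_id[symmetric] less_3_cases)
  moreover have "alt4 v c \<circ> alt4 (act ((3 - c) mod 3) v) ((3 - c) mod 3) = id"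
    using assms by (subst alt4_comp) (auto simp: alt4_id[symmetric] act_act less_3_cases simp del: act.simps, (cases v, simp)+)
  moreover have "alt4 v c x \<in> {1..4}" if "x \<in> {1..4}" for v c x
    using that by (simp add: alt4_def del: dec.simps enc.simps)
  then have "alt4 v c ` {1..4} \<subseteq> {1..4}" for v c by blast
  ultimately show "bij_betw (alt4 v c) {1..4} {1..4}"
    by (intro bij_betw_byWitness[where f' = "alt4 (act ((3 - c) mod 3) v) ((3 - c) mod 3)"])
       (simp_all only: fun_eq_iff o_apply id_apply, simp_all)
qed (simp add: alt4_def del: atLeastAtMost_iff)

lemma alt4_even: assumes "c < 3" shows "evenperm (alt4 v c)"
proof -
  have perm: "permutation (alt4 v c)" if "c < 3" for v c
    using alt4_permutes[OF that] permutation_permutes by blast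
  \<comment> \<open>The linear part g satisfies 1 + g + g^2 = 0, so the cube of the affine map is
    the identity, whereas the cube of an odd permutation is odd.\<close>
  have cube: "evenperm (alt4 v c)" if "c < 3" "c \<noteq> 0" for v c
  proof -
    have "alt4 v c \<circ> (alt4 v c \<circ> alt4 v c) = id"
    proof -
      have "alt4 v c \<circ> (alt4 v c \<circ> alt4 v c)
          = alt4 (add2 v (act c (add2 v (act c v)))) ((c + (c + c) mod 3) mod 3)"
        using that by (simp add: alt4_comp del: act.simps add2.simps)
      also have "add2 v (act c (add2 v (act c v))) = (False, False)"
        using that by (cases v) (auto simp: less_3_cases)
      also have "(c + (c + c) mod 3) mod 3 = 0" using that by (auto simp: less_3_cases)
      finally show ?thesis by (simp only: alt4_id)
    qed
    then have "evenperm (alt4 v c \<circ> (alt4 v c \<circ> alt4 v c))" by (simp add: evenperm_id)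
    then show ?thesis using that perm
      by (metis evenperm_comp permutation_compose)
  qed
  \<comment> \<open>a translation is a product of two elements of order three\<close>
  show ?thesis
  proof (cases "c = 0")
    case True
    have "alt4 v 0 = alt4 v 1 \<circ> alt4 (False, False) 2"
      by (cases v) (auto simp: alt4_comp)
    moreover have "evenperm (alt4 v 1 \<circ> alt4 (False, False) 2)"
      using cube perm by (simp add: evenperm_comp)
    ultimately show ?thesis using True by simp
  qed (use assms cube in auto)
qed

section \<open>The group law in coordinates\<close>

type_synonym coord = "bool \<times> (bool \<times> bool) \<times> nat"

definition coords :: "coord set" where
  "coords = UNIV \<times> UNIV \<times> {..<3}"

fun coord_mult :: "coord \<Rightarrow> coord \<Rightarrow> coord" where
  "coord_mult (z, v, c) (z', v', c') = (z \<noteq> z', add2 v (act c v'), (c + c') mod 3)"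

fun from_coord :: "coord \<Rightarrow> int \<times> (nat \<Rightarrow> nat)" where
  "from_coord (z, v, c) = (of_bool z, alt4 v c)"

text \<open>The value at the origin is the translation v. The orbit of (1, 0) under the linear part
  has three distinct points, so the value at (1, 0) then determines c.\<close>

lemma alt4_inj: 
  assumes "alt4 v c = alt4 v' c'" "c < 3" "c' < 3" shows "v = v' \<and> c = c'"
proof -
  have val: "enc (alt4 v c (dec w)) = add2 v (act c w)" for v c w
    by (simp add: alt4_def del: act.simps add2.simps dec.simps enc.simps)
  have "v = v'" using val[of v c "(False, False)"] val[of v' c' "(False, False)"] assms(1)
    by (simp del: enc.simps dec.simps add2.simps act.simps)
  have "add2 v (act c (True, False)) = add2 v (act c' (True, False))"
    using val[of v c "(True, False)"] val[of v' c' "(True, False)"] assms(1) \<open>v = v'\<close>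
    by (simp del: enc.simps dec.simps add2.simps act.simps)
  then have "act c (True, False) = act c' (True, False)"
    by (metis add2_assoc add2_self(1,2))
  then have "c = c'" using assms(2-) by (auto simp: less_3_cases)
  with \<open>v = v'\<close> show ?thesis by simp
qed

text \<open>The 4 * 3 affine maps are distinct even permutations of four points, and the alternating
  group has 12 elements, so they exhaust it.\<close>

lemma from_coord_bij: "bij_betw from_coord coords (carrier (integer_mod_group 2 \<times>\<times> alt_group 4))"
proof -
  let ?A = "(\<lambda>(v, c). alt4 v c) ` (UNIV \<times> {..<3})"
  have inj: "inj_on (\<lambda>(v, c). alt4 v c) (UNIV \<times> {..<3})"
    by (auto simp: inj_on_def dest: alt4_inj)
  have sub: "?A \<subseteq> carrier (alt_group 4)"
    using alt4_permutes alt4_even by (auto simp: alt_group_carrier simp del: One_nat_def)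
  have "2 * card (carrier (alt_group 4)) = fact 4" by (rule alt_group_card_carrier) simp
  then have card: "card (carrier (alt_group 4)) = 12" by (simp add: fact_numeral)
  have "?A = carrier (alt_group 4)"
  proof (rule card_subset_eq[OF _ sub])
    show "finite (carrier (alt_group 4))" using card by (metis card.infinite zero_neq_numeral)
    show "card ?A = card (carrier (alt_group 4))"
      unfolding card card_image[OF inj] by (simp add: card_cartesian_product UNIV_Times_UNIV[symmetric] del: UNIV_Times_UNIV)
  qed
  moreover have "(of_bool :: bool \<Rightarrow> int) ` UNIV = carrier (integer_mod_group 2)"
    by (auto simp: carrier_integer_mod_group UNIV_bool)
  moreover have "from_coord ` coords = (of_bool ` UNIV) \<times> ?A"
    by (force simp: coords_def)
  moreover have "inj_on from_coord coords"
    by (auto simp: inj_on_def coords_def dest: alt4_inj)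
  ultimately show ?thesis by (simp add: bij_betw_def)
qed

lemma from_coord_mult:
  assumes "u \<in> coords" "w \<in> coords"
  shows "from_coord (coord_mult u w) = from_coord u \<otimes>\<^bsub>integer_mod_group 2 \<times>\<times> alt_group 4\<^esub> from_coord w"
  using assms by (cases u; cases w) (auto simp: coords_def alt_group_mult alt4_comp)

lemma coord_mult_closed: "u \<in> coords \<Longrightarrow> w \<in> coords \<Longrightarrow> coord_mult u w \<in> coords"
  by (cases u; cases w) (auto simp: coords_def)

lemma from_coord_one: "from_coord (False, (False, False), 0) = \<one>\<^bsub>integer_mod_group 2 \<times>\<times> alt_group 4\<^esub>"
  by (simp add: alt4_id alt_group_one)

section \<open>Decomposition of the group algebra\<close>

text \<open>A linear functional with weights r is evaluated on a convolution product. Substituting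
  \<open>x = m u w\<close> for fixed u, a left translation in coordinates, turns it into a sum over
  pairs.\<close>

lemma group_algebra_functional_mult:
  fixes f g :: "'g \<Rightarrow> 'a::comm_ring_1"
  assumes G: "group G" and bij: "bij_betw \<psi> U (carrier G)" and fin: "finite U"
    and m: "\<And>u w. u \<in> U \<Longrightarrow> w \<in> U \<Longrightarrow> m u w \<in> U \<and> \<psi> (m u w) = \<psi> u \<otimes>\<^bsub>G\<^esub> \<psi> w"
  shows "(\<Sum>x\<in>U. (f \<otimes>\<^bsub>group_algebra TYPE('a) G\<^esub> g) (\<psi> x) * r x)
    = (\<Sum>u\<in>U. \<Sum>w\<in>U. f (\<psi> u) * g (\<psi> w) * r (m u w))"
proof -
  interpret group G by (rule G)
  have \<psi>: "\<psi> u \<in> carrier G" if "u \<in> U" for u using bij that by (auto simp: bij_betw_def)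
  have inj: "\<psi> u = \<psi> w \<longleftrightarrow> u = w" if "u \<in> U" "w \<in> U" for u w
    using bij that by (meson bij_betw_def inj_on_eq_iff)
  have bijm: "bij_betw (m u) U U" if u: "u \<in> U" for u
  proof -
    have "inj_on (m u) U"
    proof (rule inj_onI)
      fix v w assume vw: "v \<in> U" "w \<in> U" "m u v = m u w"
      then have "\<psi> u \<otimes>\<^bsub>G\<^esub> \<psi> v = \<psi> u \<otimes>\<^bsub>G\<^esub> \<psi> w" using m[OF u] by metis
      then show "v = w" using vw \<psi> u inj by simp
    qed
    moreover have "m u ` U \<subseteq> U" using m u by blast
    ultimately show ?thesis using fin by (simp add: bij_betw_def endo_inj_surj)
  qed
  have "(\<Sum>x\<in>U. (f \<otimes>\<^bsub>group_algebra TYPE('a) G\<^esub> g) (\<psi> x) * r x)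
      = (\<Sum>x\<in>U. \<Sum>u\<in>U. f (\<psi> u) * g (inv\<^bsub>G\<^esub> (\<psi> u) \<otimes>\<^bsub>G\<^esub> \<psi> x) * r x)"
    by (rule sum.cong) (simp_all add: group_algebra_def \<psi> sum_distrib_right
          sum.reindex_bij_betw[OF bij, symmetric])
  also have "\<dots> = (\<Sum>u\<in>U. \<Sum>x\<in>U. f (\<psi> u) * g (inv\<^bsub>G\<^esub> (\<psi> u) \<otimes>\<^bsub>G\<^esub> \<psi> x) * r x)"
    by (rule sum.swap)
  also have "\<dots> = (\<Sum>u\<in>U. \<Sum>w\<in>U. f (\<psi> u) * g (\<psi> w) * r (m u w))"
  proof (rule sum.cong)
    fix u assume u: "u \<in> U"
    have "(\<Sum>x\<in>U. f (\<psi> u) * g (inv\<^bsub>G\<^esub> (\<psi> u) \<otimes>\<^bsub>G\<^esub> \<psi> x) * r x)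
        = (\<Sum>w\<in>U. f (\<psi> u) * g (inv\<^bsub>G\<^esub> (\<psi> u) \<otimes>\<^bsub>G\<^esub> \<psi> (m u w)) * r (m u w))"
      by (rule sum.reindex_bij_betw[OF bijm[OF u], symmetric])
    also have "\<dots> = (\<Sum>w\<in>U. f (\<psi> u) * g (\<psi> w) * r (m u w))"
      using m u \<psi> by (intro sum.cong) (auto simp: m_assoc[symmetric])
    finally show "(\<Sum>x\<in>U. f (\<psi> u) * g (inv\<^bsub>G\<^esub> (\<psi> u) \<otimes>\<^bsub>G\<^esub> \<psi> x) * r x)
        = (\<Sum>w\<in>U. f (\<psi> u) * g (\<psi> w) * r (m u w))" .
  qed simp
  finally show ?thesis .
qed

text \<open>The linear extension of a matrix representation is multiplicative. Fixing i and j keeps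
  index bounds out of the hypothesis on r.\<close>

lemma group_algebra_matrix_mult:
  fixes f g :: "'g \<Rightarrow> 'a::comm_ring_1"
  assumes G: "group G" and bij: "bij_betw \<psi> U (carrier G)" and fin: "finite U"
    and m: "\<And>u w. u \<in> U \<Longrightarrow> w \<in> U \<Longrightarrow> m u w \<in> U \<and> \<psi> (m u w) = \<psi> u \<otimes>\<^bsub>G\<^esub> \<psi> w"
    and r: "\<And>u w. u \<in> U \<Longrightarrow> w \<in> U \<Longrightarrow> r (m u w) i j = (\<Sum>k\<in>K. r u i k * r w k j)"
  shows "(\<Sum>x\<in>U. (f \<otimes>\<^bsub>group_algebra TYPE('a) G\<^esub> g) (\<psi> x) * r x i j)
    = (\<Sum>k\<in>K. (\<Sum>x\<in>U. f (\<psi> x) * r x i k) * (\<Sum>x\<in>U. g (\<psi> x) * r x k j))"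
proof -
  have "(\<Sum>x\<in>U. (f \<otimes>\<^bsub>group_algebra TYPE('a) G\<^esub> g) (\<psi> x) * r x i j)
      = (\<Sum>u\<in>U. \<Sum>w\<in>U. f (\<psi> u) * g (\<psi> w) * r (m u w) i j)"
    by (rule group_algebra_functional_mult[OF G bij fin m])
  also have "\<dots> = (\<Sum>u\<in>U. \<Sum>w\<in>U. \<Sum>k\<in>K. (f (\<psi> u) * r u i k) * (g (\<psi> w) * r w k j))"
    by (intro sum.cong refl) (simp add: r sum_distrib_left algebra_simps)
  also have "\<dots> = (\<Sum>u\<in>U. \<Sum>k\<in>K. \<Sum>w\<in>U. (f (\<psi> u) * r u i k) * (g (\<psi> w) * r w k j))"
    by (intro sum.cong refl sum.swap)
  also have "\<dots> = (\<Sum>k\<in>K. \<Sum>u\<in>U. \<Sum>w\<in>U. (f (\<psi> u) * r u i k) * (g (\<psi> w) * r w k j))"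
    by (rule sum.swap)
  also have "\<dots> = (\<Sum>k\<in>K. (\<Sum>x\<in>U. f (\<psi> x) * r x i k) * (\<Sum>x\<in>U. g (\<psi> x) * r x k j))"
    by (simp add: sum_product)
  finally show ?thesis .
qed

section \<open>Sign characters and induced monomial representations\<close>

definition sg :: "bool \<Rightarrow> 'a::ring_1" where "sg b = (if b then - 1 else 1)"

text \<open>In odd characteristic these are the three nontrivial characters of the Klein four-group,
  numbered so that precomposition with \<open>act c\<close> shifts the index by c.\<close>

fun chi :: "nat \<Rightarrow> bool \<times> bool \<Rightarrow> 'a::ring_1" where
  "chi i (a, b) = (if i = 0 then sg a else if i = 1 then sg b else sg (a \<noteq> b))"

lemma chi_add2: "chi i (add2 v w) = (chi i v * chi i w :: 'a::comm_ring_1)"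
  by (cases v; cases w) (auto simp: sg_def)

lemma chi_act: "i < 3 \<Longrightarrow> c < 3 \<Longrightarrow> chi i (act c v) = chi ((i + c) mod 3) v"
  by (cases v) (auto simp: less_3_cases sg_def)

text \<open>
  The representation induced from a character of \<open>C\<^sub>2\<^sup>3\<close>. The flag \<open>e\<close> selects the character of the factor
  \<open>C\<^sub>2\<close>. If \<open>d\<close> holds, the character of the Klein four-group is nontrivial; otherwise it is trivial
  and the matrices are circulant.
\<close>

fun monomial_rep :: "bool \<Rightarrow> bool \<Rightarrow> coord \<Rightarrow> nat \<Rightarrow> nat \<Rightarrow> 'a::comm_ring_1" where
  "monomial_rep e d (z, v, c) i j =
    sg (e \<and> z) * (if d then chi i v else 1) * (if j = (i + c) mod 3 then 1 else 0)"

text \<open>Row i of the matrix of (z, v, c) has its only nonzero entry in column (i + c) mod 3, so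
  the sum over k has a single term. The two character values then match by
  \<open>chi_act\<close>.\<close>

lemma monomial_rep_mult:
  assumes "u \<in> coords" "w \<in> coords" "i < 3"
  shows "monomial_rep e d (coord_mult u w) i j
    = (\<Sum>k<3. monomial_rep e d u i k * monomial_rep e d w k j :: 'a::comm_ring_1)"
proof -
  obtain z v c z' v' c' where uw: "u = (z, v, c)" "w = (z', v', c')" by (metis prod.exhaust)
  have c: "c < 3" "c' < 3" using assms by (auto simp: uw coords_def)
  have "(\<Sum>k<3. monomial_rep e d u i k * monomial_rep e d w k j :: 'a)
      = (\<Sum>k<3. if (i + c) mod 3 = k then sg (e \<and> z) * (if d then chi i v else 1)
            * monomial_rep e d w ((i + c) mod 3) j else 0)"
    by (intro sum.cong refl) (simp add: uw)
  also have "\<dots> = sg (e \<and> z) * (if d then chi i v else 1) * monomial_rep e d w ((i + c) mod 3) j"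
    by (simp only: sum.delta' finite_lessThan) simp
  also have "\<dots> = monomial_rep e d (coord_mult u w) i j"
    using c assms(3) by (simp add: uw chi_add2 chi_act sg_def add.assoc mod_simps del: act.simps add2.simps chi.simps)
  finally show ?thesis by simp
qed

definition rep :: "bool \<Rightarrow> bool \<Rightarrow> (int \<times> (nat \<Rightarrow> nat) \<Rightarrow> 'a) \<Rightarrow> nat \<Rightarrow> nat \<Rightarrow> 'a::comm_ring_1" where
  "rep e d f i j = (\<Sum>u\<in>coords. f (from_coord u) * monomial_rep e d u i j)"

lemma group_C2_A4: "group (integer_mod_group 2 \<times>\<times> alt_group 4)"
  by (simp add: DirProd_group alt_group_is_group)

lemma finite_coords: "finite coords"
  by (auto simp: coords_def)

lemma rep_mult:
  fixes f g :: "int \<times> (nat \<Rightarrow> nat) \<Rightarrow> 'a::comm_ring_1"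
  assumes "i < 3"
  shows "rep e d (f \<otimes>\<^bsub>group_algebra TYPE('a) (integer_mod_group 2 \<times>\<times> alt_group 4)\<^esub> g) i j
    = (\<Sum>k<3. rep e d f i k * rep e d g k j)"
  unfolding rep_def
  by (rule group_algebra_matrix_mult[OF group_C2_A4 from_coord_bij finite_coords, of coord_mult])
     (use assms in \<open>auto simp: coord_mult_closed from_coord_mult monomial_rep_mult simp del: monomial_rep.simps\<close>)

lemma rep_one:
  assumes "i < 3" "j < 3"
  shows "rep e d (\<one>\<^bsub>group_algebra TYPE('a::comm_ring_1) (integer_mod_group 2 \<times>\<times> alt_group 4)\<^esub>) i j
    = (if i = j then 1 else 0)"
proof -
  have one: "(False, (False, False), 0) \<in> coords" by (simp add: coords_def)
  have "from_coord u = \<one>\<^bsub>integer_mod_group 2 \<times>\<times> alt_group 4\<^esub> \<longleftrightarrow> (False, (False, False), 0) = u"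
    if "u \<in> coords" for u
    unfolding from_coord_one[symmetric]
    using from_coord_bij one that by (metis bij_betw_def inj_on_eq_iff)
  then have "\<one>\<^bsub>group_algebra TYPE('a) (integer_mod_group 2 \<times>\<times> alt_group 4)\<^esub> (from_coord u)
      = (if (False, (False, False), 0) = u then 1 else 0)" if "u \<in> coords" for u
    using that by (simp add: group_algebra_def del: one_DirProd from_coord.simps)
  then have "rep e d (\<one>\<^bsub>group_algebra TYPE('a) (integer_mod_group 2 \<times>\<times> alt_group 4)\<^esub>) i j
      = (\<Sum>u\<in>coords. if (False, (False, False), 0) = u then monomial_rep e d u i j else 0)"
    unfolding rep_def by (intro sum.cong) auto
  also have "\<dots> = (if i = j then 1 else 0)"
    using assms one by (simp add: sum.delta' finite_coords sg_def)
  finally show ?thesis .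
qed

text \<open>Position (i, i + c) sees only the coset with index c, so the cosets decouple. On each
  coset there are 8 coefficients and 2 * (1 + 3) independent entries, one for each character of the
  normal subgroup of order 8.\<close>

lemma rep_entry:
  assumes "i < 3" "c < 3"
  shows "rep e d f i ((i + c) mod 3) = (\<Sum>z\<in>UNIV. \<Sum>v\<in>UNIV. 
     f (from_coord (z, v, c)) * (sg (e \<and> z) * (if d then chi i v else 1)))"
proof -
  have eq: "(i + c) mod 3 = (i + c') mod 3 \<longleftrightarrow> c' = c" if "c' < 3" for c'
    using assms that by (auto simp: less_3_cases)
  have "rep e d f i ((i + c) mod 3) = (\<Sum>z\<in>UNIV. \<Sum>v\<in>UNIV. \<Sum>c'<3.
      if c' = c then f (from_coord (z, v, c)) * (sg (e \<and> z) * (if d then chi i v else 1)) else 0)"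
    unfolding rep_def coords_def sum.cartesian_product
    by (rule sum.cong) (auto simp: eq)
  then show ?thesis using assms by simp
qed

section \<open>Fourier inversion on the elementary abelian group of order 8\<close>

lemma sum_UNIV_bool: "(\<Sum>b\<in>UNIV. f b) = f False + f True"
  by (simp add: UNIV_bool add.commute)

lemma sum_UNIV_bool2:
  "(\<Sum>v\<in>UNIV. f v) = f (False, False) + f (False, True) + f (True, False) + f (True, True)"
proof -
  have U: "UNIV = {(False, False), (False, True), (True, False), (True, True)}" by auto
  show ?thesis unfolding U by (simp add: add.assoc)
qed

lemma sum_less_3: "(\<Sum>i<3. f i) = f 0 + f 1 + f (2::nat)"
  by (simp add: numeral_eq_Suc)

text \<open>The inverse transform without the factor 1/8. The values at the eight characters are
  split into T, for those trivial on the Klein four-group, and M, for the others; the inversion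
  lemmas are the orthogonality relations.\<close>

definition hadamard :: "(bool \<Rightarrow> 'a) \<Rightarrow> (bool \<Rightarrow> nat \<Rightarrow> 'a) \<Rightarrow> bool \<Rightarrow> bool \<times> bool \<Rightarrow> 'a::comm_ring_1" where
  "hadamard T M z v = (\<Sum>e\<in>UNIV. sg (e \<and> z) * (T e + (\<Sum>i<3. chi i v * M e i)))"

lemma hadamard_inverse_1:
  "(\<Sum>z\<in>UNIV. \<Sum>v\<in>UNIV. hadamard T M z v * sg (e \<and> z)) = 8 * T e"
  by (cases e) (simp_all add: hadamard_def sum_UNIV_bool sum_UNIV_bool2 sum_less_3 sg_def algebra_simps)

lemma hadamard_inverse_2:
  assumes "i < 3"
  shows "(\<Sum>z\<in>UNIV. \<Sum>v\<in>UNIV. hadamard T M z v * (sg (e \<and> z) * chi i v)) = 8 * M e i"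
  using assms unfolding less_3_cases
  by (cases e; elim disjE)
    (simp_all add: hadamard_def sum_UNIV_bool sum_UNIV_bool2 sum_less_3 sg_def algebra_simps)

text \<open>The factor \<open>1\<close> preserves the shape of \<open>rep_entry\<close> in the case
  of a trivial character.\<close>

lemma hadamard_inverse_3:
  "hadamard (\<lambda>e. \<Sum>z\<in>UNIV. \<Sum>v\<in>UNIV. F z v * (sg (e \<and> z) * 1))
    (\<lambda>e i. \<Sum>z\<in>UNIV. \<Sum>v\<in>UNIV. F z v * (sg (e \<and> z) * chi i v)) z v = 8 * F z v"
  by (cases z; cases v; cases "fst v"; cases "snd v")
    (simp_all add: hadamard_def sum_UNIV_bool sum_UNIV_bool2 sum_less_3 sg_def algebra_simps)

text \<open>The group algebra of \<open>C\<^sub>3\<close>, on triples of coefficients (first rows of circulant matrices).\<close>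

definition cyc3 :: "'a::comm_ring_1 itself \<Rightarrow> ('a \<times> 'a \<times> 'a) monoid" where
  "cyc3 ty = \<lparr>carrier = UNIV,
     monoid.mult = (\<lambda>(a, b, c) (a', b', c').
       (a * a' + b * c' + c * b', a * b' + b * a' + c * c', a * c' + b * b' + c * a')),
     one = (1, 0, 0)\<rparr>"

definition row3 :: "(nat \<Rightarrow> nat \<Rightarrow> 'a) \<Rightarrow> 'a \<times> 'a \<times> 'a" where
  "row3 A = (A 0 0, A 0 1, A 0 2)"

section \<open>The four blocks and bijectivity of the decomposition\<close>

definition decomposition :: "(int \<times> (nat \<Rightarrow> nat) \<Rightarrow> 'a::comm_ring_1) \<Rightarrow>
    (('a \<times> 'a \<times> 'a) \<times> 'a mat) \<times> ('a \<times> 'a \<times> 'a) \<times> 'a mat" where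
  "decomposition f =
    ((row3 (rep False False f), mat 3 3 (\<lambda>(i, j). rep False True f i j)),
     (row3 (rep True False f), mat 3 3 (\<lambda>(i, j). rep True True f i j)))"

text \<open>Without the factor \<open>chi\<close> an entry depends only on j - i modulo 3; adding 3
  avoids truncated subtraction. Thus the first row retains the whole block.\<close>

lemma rep_circulant:
  assumes "i < 3" "j < 3"
  shows "rep e False f i j = rep e False f 0 ((j + 3 - i) mod 3)"
  unfolding rep_def
proof (rule sum.cong)
  fix u assume "u \<in> coords"
  then obtain z v c where u: "u = (z, v, c)" "c < 3" by (auto simp: coords_def)
  have "(j = (i + c) mod 3) = ((j + 3 - i) mod 3 = c)"
    using assms u(2) unfolding less_3_cases by (elim disjE) simp_all
  then show "f (from_coord u) * monomial_rep e False u i j =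
      f (from_coord u) * monomial_rep e False u 0 ((j + 3 - i) mod 3)"
    using u by simp
qed simp

lemma row3_rep_mult:
  fixes f g :: "int \<times> (nat \<Rightarrow> nat) \<Rightarrow> 'a::comm_ring_1"
  shows "row3 (rep e False (f \<otimes>\<^bsub>group_algebra TYPE('a) (integer_mod_group 2 \<times>\<times> alt_group 4)\<^esub> g))
    = row3 (rep e False f) \<otimes>\<^bsub>cyc3 TYPE('a)\<^esub> row3 (rep e False g)"
  using rep_circulant[of 1 0 e g] rep_circulant[of 1 1 e g] rep_circulant[of 1 2 e g]
    rep_circulant[of 2 0 e g] rep_circulant[of 2 1 e g] rep_circulant[of 2 2 e g]
  by (simp add: row3_def cyc3_def rep_mult sum_less_3)

lemma mat_rep_mult:
  fixes f g :: "int \<times> (nat \<Rightarrow> nat) \<Rightarrow> 'a::comm_ring_1"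
  shows "mat 3 3 (\<lambda>(i, j). rep e d (f \<otimes>\<^bsub>group_algebra TYPE('a) (integer_mod_group 2 \<times>\<times> alt_group 4)\<^esub> g) i j)
    = mat 3 3 (\<lambda>(i, j). rep e d f i j) * mat 3 3 (\<lambda>(i, j). rep e d g i j)"
  by (rule eq_matI) (auto simp: rep_mult scalar_prod_def atLeast0LessThan)

lemma decomposition_hom:
  "(decomposition :: (int \<times> (nat \<Rightarrow> nat) \<Rightarrow> 'a::comm_ring_1) \<Rightarrow> _)
    \<in> hom (group_algebra TYPE('a) (integer_mod_group 2 \<times>\<times> alt_group 4))
     ((cyc3 TYPE('a) \<times>\<times> ring_mat TYPE('a) 3 ()) \<times>\<times> (cyc3 TYPE('a) \<times>\<times> ring_mat TYPE('a) 3 ()))"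
  by (rule homI) (auto simp: decomposition_def row3_rep_mult mat_rep_mult ring_mat_simps cyc3_def[THEN arg_cong[where f = carrier]])

lemma decomposition_one:
  "decomposition (\<one>\<^bsub>group_algebra TYPE('a::comm_ring_1) (integer_mod_group 2 \<times>\<times> alt_group 4)\<^esub>)
    = \<one>\<^bsub>(cyc3 TYPE('a) \<times>\<times> ring_mat TYPE('a) 3 ()) \<times>\<times> (cyc3 TYPE('a) \<times>\<times> ring_mat TYPE('a) 3 ())\<^esub>"
  by (auto simp: decomposition_def row3_def rep_one cyc3_def ring_mat_simps intro!: eq_matI)

text \<open>By \<open>hadamard_inverse_3\<close> the entries belonging to a coset determine eight
  times the coefficients there, and 8 is cancelled.\<close>

lemma decomposition_inj:
  assumes "(8::'a::field) \<noteq> 0"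
  shows "inj_on (decomposition :: _ \<Rightarrow> (('a \<times> 'a \<times> 'a) \<times> 'a mat) \<times> _)
    (carrier (group_algebra TYPE('a) (integer_mod_group 2 \<times>\<times> alt_group 4)))"
proof (rule inj_onI)
  fix f g assume f: "f \<in> carrier (group_algebra TYPE('a) (integer_mod_group 2 \<times>\<times> alt_group 4))"
    and g: "g \<in> carrier (group_algebra TYPE('a) (integer_mod_group 2 \<times>\<times> alt_group 4))"
    and eq: "decomposition f = decomposition g"
  have M: "rep e True f i j = rep e True g i j" if "i < 3" "j < 3" for e i j
  proof -
    have "mat 3 3 (\<lambda>(i, j). rep e True f i j) = mat 3 3 (\<lambda>(i, j). rep e True g i j)"
      using eq by (cases e) (simp_all add: decomposition_def)
    then have "mat 3 3 (\<lambda>(i, j). rep e True f i j) $$ (i, j) = mat 3 3 (\<lambda>(i, j). rep e True g i j) $$ (i, j)"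
      by simp
    then show ?thesis using that by simp
  qed
  have T: "rep e False f 0 c = rep e False g 0 c" if "c < 3" for e c
    using eq that unfolding less_3_cases by (cases e) (auto simp: decomposition_def row3_def)
  have H: "8 * f (from_coord (z, v, c))
      = hadamard (\<lambda>e. rep e False f 0 c) (\<lambda>e i. rep e True f i ((i + c) mod 3)) z v"
    if "c < 3" for f :: "int \<times> (nat \<Rightarrow> nat) \<Rightarrow> 'a" and z v c
  proof -
    have "hadamard (\<lambda>e. rep e False f 0 c) (\<lambda>e i. rep e True f i ((i + c) mod 3)) z v
      = hadamard (\<lambda>e. \<Sum>z\<in>UNIV. \<Sum>v\<in>UNIV. f (from_coord (z, v, c)) * (sg (e \<and> z) * 1))
      (\<lambda>e i. \<Sum>z\<in>UNIV. \<Sum>v\<in>UNIV. f (from_coord (z, v, c)) * (sg (e \<and> z) * chi i v)) z v"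
      using rep_entry[of 0 c _ False f] rep_entry[OF _ that, of _ _ True f] that
      unfolding hadamard_def by simp
    then show ?thesis by (simp only: hadamard_inverse_3)
  qed
  have "f (from_coord u) = g (from_coord u)" if "u \<in> coords" for u
  proof -
    obtain z v c where u: "u = (z, v, c)" by (rule prod_cases3)
    then have c: "c < 3" using that by (simp add: coords_def)
    have "8 * f (from_coord (z, v, c)) = 8 * g (from_coord (z, v, c))"
      unfolding H[OF c] hadamard_def using M T c by simp
    then show ?thesis using assms u by (simp del: from_coord.simps)
  qed
  then have "f x = g x" if "x \<in> carrier (integer_mod_group 2 \<times>\<times> alt_group 4)" for x
    using from_coord_bij that unfolding bij_betw_def by (metis imageE)
  moreover have "f x = g x" if "x \<notin> carrier (integer_mod_group 2 \<times>\<times> alt_group 4)" for x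
    using f g that by (cases x) (simp add: group_algebra_def del: carrier_DirProd)
  ultimately show "f = g" by blast
qed

text \<open>The preimage is the inverse transform of the prescribed entries, taken coset by coset
  and divided by 8.\<close>

lemma decomposition_surj:
  fixes T :: "bool \<Rightarrow> nat \<Rightarrow> 'a::field"
  assumes "(8::'a) \<noteq> 0"
  shows "\<exists>f \<in> carrier (group_algebra TYPE('a) (integer_mod_group 2 \<times>\<times> alt_group 4)).
    (\<forall>e. \<forall>j<3. rep e False f 0 j = T e j) \<and> (\<forall>e. \<forall>i<3. \<forall>j<3. rep e True f i j = M e i j)"
proof -
  let ?G = "integer_mod_group 2 \<times>\<times> alt_group 4"
  define F where "F = (\<lambda>(z, v, c). hadamard (\<lambda>e. T e c) (\<lambda>e i. M e i ((i + c) mod 3)) z v / 8)"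
  define f where "f = (\<lambda>x. if x \<in> carrier ?G then F (inv_into coords from_coord x) else 0)"
  have fF: "f (from_coord u) = F u" if "u \<in> coords" for u
    using from_coord_bij that unfolding f_def bij_betw_def by auto
  have fF': "f (from_coord (z, v, c)) = F (z, v, c)" if "c < 3" for z v c
    using that by (intro fF) (simp add: coords_def)
  have "rep e False f 0 c = T e c" if "c < 3" for e c
  proof -
    have "rep e False f 0 c
        = (\<Sum>z\<in>UNIV. \<Sum>v\<in>UNIV. hadamard (\<lambda>e. T e c) (\<lambda>e i. M e i ((i + c) mod 3)) z v * sg (e \<and> z)) / 8"
      using rep_entry[of 0 c e False f] that unfolding fF'[OF that]
      by (simp add: F_def sum_divide_distrib)
    then show ?thesis using assms(1) unfolding hadamard_inverse_1 by simp
  qed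
  moreover have "rep e True f i j = M e i j" if "i < 3" "j < 3" for e i j
  proof -
    define c where "c = (j + 3 - i) mod 3"
    have c: "c < 3" "(i + c) mod 3 = j" using that unfolding less_3_cases by (auto simp: c_def)
    have "rep e True f i ((i + c) mod 3)
        = (\<Sum>z\<in>UNIV. \<Sum>v\<in>UNIV. hadamard (\<lambda>e. T e c) (\<lambda>e i. M e i ((i + c) mod 3)) z v * (sg (e \<and> z) * chi i v)) / 8"
      using rep_entry[OF that(1) c(1), of e True f] unfolding fF'[OF c(1)]
      by (simp add: F_def sum_divide_distrib)
    then show ?thesis using assms(1) unfolding hadamard_inverse_2[OF that(1)] c(2) by simp
  qed
  moreover have "f \<in> carrier (group_algebra TYPE('a) ?G)"
    by (simp add: group_algebra_def f_def del: carrier_DirProd)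
  ultimately show ?thesis by blast
qed

lemma decomposition_bij:
  assumes "(8::'a::field) \<noteq> 0"
  shows "bij_betw (decomposition :: _ \<Rightarrow> (('a \<times> 'a \<times> 'a) \<times> 'a mat) \<times> _)
    (carrier (group_algebra TYPE('a) (integer_mod_group 2 \<times>\<times> alt_group 4)))
    (carrier ((cyc3 TYPE('a) \<times>\<times> ring_mat TYPE('a) 3 ()) \<times>\<times> (cyc3 TYPE('a) \<times>\<times> ring_mat TYPE('a) 3 ())))"
  unfolding bij_betw_def
proof (intro conjI decomposition_inj assms equalityI subsetI)
  fix y assume "y \<in> decomposition ` carrier (group_algebra TYPE('a) (integer_mod_group 2 \<times>\<times> alt_group 4))"
  then show "y \<in> carrier ((cyc3 TYPE('a) \<times>\<times> ring_mat TYPE('a) 3 ()) \<times>\<times> (cyc3 TYPE('a) \<times>\<times> ring_mat TYPE('a) 3 ()))"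
    using decomposition_hom by (auto simp: hom_def)
next
  fix y assume "y \<in> carrier ((cyc3 TYPE('a) \<times>\<times> ring_mat TYPE('a) 3 ()) \<times>\<times> (cyc3 TYPE('a) \<times>\<times> ring_mat TYPE('a) 3 ()))"
  then obtain a b c A a' b' c' A' where y: "y = (((a, b, c), A), ((a', b', c'), A'))"
    and A: "A \<in> carrier_mat 3 3" "A' \<in> carrier_mat 3 3"
    by (auto simp: ring_mat_simps)
  define T where "T = (\<lambda>e j. if e then (if j = 0 then a' else if j = 1 then b' else c')
    else (if j = (0::nat) then a else if j = 1 then b else c))"
  obtain f where f: "f \<in> carrier (group_algebra TYPE('a) (integer_mod_group 2 \<times>\<times> alt_group 4))"
    and T: "\<And>e j. j < 3 \<Longrightarrow> rep e False f 0 j = T e j"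
    and M: "\<And>e i j. i < 3 \<Longrightarrow> j < 3 \<Longrightarrow> rep e True f i j = (if e then A' else A) $$ (i, j)"
    using decomposition_surj[OF assms, of T "\<lambda>e i j. (if e then A' else A) $$ (i, j)"] by metis
  have "mat 3 3 (\<lambda>(i, j). rep False True f i j) = A" "mat 3 3 (\<lambda>(i, j). rep True True f i j) = A'"
    using A by (auto simp: M intro!: eq_matI)
  then have "decomposition f = y"
    by (simp add: decomposition_def y row3_def T T_def)
  with f show "y \<in> decomposition ` carrier (group_algebra TYPE('a) (integer_mod_group 2 \<times>\<times> alt_group 4))"
    by blast
qed

lemma units_group_algebra_iso:
  assumes "(8::'a::field) \<noteq> 0"
  shows "units_of (group_algebra TYPE('a) (integer_mod_group 2 \<times>\<times> alt_group 4))
    \<cong> (units_of (cyc3 TYPE('a)) \<times>\<times> units_of (cyc3 TYPE('a))) \<times>\<times> group_power (GL 3 TYPE('a)) 2"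
proof -
  have "units_of (group_algebra TYPE('a) (integer_mod_group 2 \<times>\<times> alt_group 4))
      \<cong> units_of ((cyc3 TYPE('a) \<times>\<times> ring_mat TYPE('a) 3 ()) \<times>\<times> (cyc3 TYPE('a) \<times>\<times> ring_mat TYPE('a) 3 ()))"
  proof (rule units_of_iso)
    show "(decomposition :: _ \<Rightarrow> (('a \<times> 'a \<times> 'a) \<times> 'a mat) \<times> _) (\<one>\<^bsub>group_algebra TYPE('a::field) (integer_mod_group 2 \<times>\<times> alt_group 4)\<^esub>)
    = \<one>\<^bsub>(cyc3 TYPE('a) \<times>\<times> ring_mat TYPE('a) 3 ()) \<times>\<times> (cyc3 TYPE('a) \<times>\<times> ring_mat TYPE('a) 3 ())\<^esub>"
      by (rule decomposition_one)
    show "decomposition \<in> iso (group_algebra TYPE('a) (integer_mod_group 2 \<times>\<times> alt_group 4))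
      ((cyc3 TYPE('a) \<times>\<times> ring_mat TYPE('a) 3 ()) \<times>\<times> (cyc3 TYPE('a) \<times>\<times> ring_mat TYPE('a) 3 ()))"
      using decomposition_hom decomposition_bij[OF assms] by (simp add: iso_def)
  qed (auto simp: group_algebra_def alt_group_carrier alt_group_one carrier_integer_mod_group)
  also have "\<dots> = (units_of (cyc3 TYPE('a)) \<times>\<times> GL 3 TYPE('a)) \<times>\<times> (units_of (cyc3 TYPE('a)) \<times>\<times> GL 3 TYPE('a))"
    by (simp only: units_of_DirProd GL_def)
  also have "\<dots> \<cong> (units_of (cyc3 TYPE('a)) \<times>\<times> units_of (cyc3 TYPE('a))) \<times>\<times> (GL 3 TYPE('a) \<times>\<times> GL 3 TYPE('a))"
    by (rule DirProd_swap_middle_iso)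
  also have "\<dots> \<cong> (units_of (cyc3 TYPE('a)) \<times>\<times> units_of (cyc3 TYPE('a))) \<times>\<times> group_power (GL 3 TYPE('a)) 2"
    by (intro DirProd_is_iso_cong iso_refl group_power_2_iso)
  finally show ?thesis .
qed

section \<open>Units of the group algebra of \<open>C\<^sub>3\<close>\<close>

text \<open>The coefficient field as a record, to which the results on fields and unit groups
  apply.\<close>

definition type_ring :: "'a::field itself \<Rightarrow> 'a ring" where
  "type_ring ty = \<lparr>carrier = UNIV, monoid.mult = (*), one = 1, ring.zero = 0, ring.add = (+)\<rparr>"

lemma field_type_ring: "field (type_ring TYPE('a::field))"
proof (rule cring.cring_fieldI)
  show "cring (type_ring TYPE('a))"
  proof (rule cringI)
    show "abelian_group (type_ring TYPE('a))"
    proof (rule abelian_groupI)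
      fix x assume "x \<in> carrier (type_ring TYPE('a))"
      show "\<exists>y\<in>carrier (type_ring TYPE('a)). y \<oplus>\<^bsub>type_ring TYPE('a)\<^esub> x = \<zero>\<^bsub>type_ring TYPE('a)\<^esub>"
        by (rule bexI[of _ "- x"]) (simp_all add: type_ring_def)
    qed (simp_all add: type_ring_def add.assoc add.commute)
    show "comm_monoid (type_ring TYPE('a))"
      by (rule comm_monoidI) (simp_all add: type_ring_def mult.assoc mult.commute)
  qed (simp add: type_ring_def distrib_right)
  have "\<exists>y. y * x = 1 \<and> x * y = 1" if "x \<noteq> 0" for x :: 'a
    using that by (intro exI[of _ "inverse x"]) simp
  then show "Units (type_ring TYPE('a)) = carrier (type_ring TYPE('a)) - {\<zero>\<^bsub>type_ring TYPE('a)\<^esub>}"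
    by (auto simp: Units_def type_ring_def)
qed

lemma units_type_ring_iso:
  "units_of (type_ring TYPE('a::{field,finite})) \<cong> integer_mod_group (CARD('a) - 1)"
  using field.finite_units_iso[OF field_type_ring[where 'a = 'a]]
  by (simp add: type_ring_def order_def)

lemma Units_type_ring: "x \<in> Units (type_ring TYPE('a::field)) \<longleftrightarrow> x \<noteq> 0"
  using field.field_Units[OF field_type_ring[where 'a = 'a]] by (auto simp: type_ring_def)

section \<open>Cube roots of unity through discrete logarithms\<close>

lemma nonzero_discrete_log:
  "\<exists>h :: 'a::{field,finite} \<Rightarrow> int. bij_betw h (- {0}) {0..<int (CARD('a) - 1)} \<and> h 1 = 0 \<and>
    (\<forall>x y. x \<noteq> 0 \<longrightarrow> y \<noteq> 0 \<longrightarrow> h (x * y) = (h x + h y) mod int (CARD('a) - 1))"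
proof -
  obtain h where h: "h \<in> iso (units_of (type_ring TYPE('a))) (integer_mod_group (CARD('a) - 1))"
    using units_type_ring_iso[where 'a = 'a] by (auto simp: is_iso_def)
  have "CARD('a) > 1"
  proof -
    have "card {0::'a, 1} \<le> CARD('a)" by (rule card_mono) auto
    then show ?thesis by simp
  qed
  moreover have "Units (type_ring TYPE('a)) = - {0}" by (auto simp: Units_type_ring)
  ultimately have bij: "bij_betw h (- {0}) {0..<int (CARD('a) - 1)}"
    using h by (simp add: iso_def units_of_carrier carrier_integer_mod_group)
  have mult: "h (x * y) = (h x + h y) mod int (CARD('a) - 1)" if "x \<noteq> 0" "y \<noteq> 0" for x y
  proof -
    have "h (x \<otimes>\<^bsub>units_of (type_ring TYPE('a))\<^esub> y) = h x \<otimes>\<^bsub>integer_mod_group (CARD('a) - 1)\<^esub> h y"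
      using h that by (intro hom_mult) (auto simp: iso_def units_of_carrier Units_type_ring)
    then show ?thesis by (simp add: units_of_mult type_ring_def)
  qed
  have h1: "0 \<le> h 1" "h 1 < int (CARD('a) - 1)" using bij by (auto simp: bij_betw_def)
  have "(h 1 + h 1) mod int (CARD('a) - 1) = h 1 mod int (CARD('a) - 1)"
    using mult[of 1 1] h1 by simp
  then have "int (CARD('a) - 1) dvd h 1" by (simp add: mod_eq_dvd_iff)
  then have "h 1 = 0" using h1 by (metis dvd_imp_mod_0 mod_pos_pos_trivial)
  with bij mult show ?thesis by blast
qed

text \<open>With \<open>CARD('a) - 1 = 3 * m\<close>, the element of discrete logarithm m is a cube
  root of unity other than 1, hence a root of x^2 + x + 1. The equation is oriented to rewrite
  squares of w.\<close>

lemma primitive_cube_root_exists: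
  assumes "CARD('a::{field,finite}) mod 3 = 1"
  obtains w :: "'a::{field,finite}" where "w * w = - 1 - w"
proof -
  obtain h :: "'a \<Rightarrow> int" where bij: "bij_betw h (- {0}) {0..<int (CARD('a) - 1)}"
    and mult: "\<And>x y. x \<noteq> 0 \<Longrightarrow> y \<noteq> 0 \<Longrightarrow> h (x * y) = (h x + h y) mod int (CARD('a) - 1)" and h1: "h 1 = 0"
    using nonzero_discrete_log[where 'a = 'a] by blast
  have "card {0::'a, 1} \<le> CARD('a)" by (rule card_mono) auto
  moreover define m where "m = CARD('a) div 3"
  ultimately have m: "CARD('a) - 1 = 3 * m" "m > 0" using assms by auto presburger+
  then have "int m \<in> {0..<int (CARD('a) - 1)}" by auto
  then obtain w where w: "w \<noteq> 0" "h w = int m" using bij by (metis ComplD bij_betw_def imageE singletonI)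
  have "h (w * w * w) = h 1" using w m by (simp add: mult h1 mod_simps)
  then have "w * w * w = 1" using bij w(1) by (auto simp: bij_betw_def dest!: inj_onD)
  moreover have "w \<noteq> 1" using w(2) h1 m by auto
  moreover have "(w - 1) * (w * w + w + 1) = w * w * w - 1" by (simp add: algebra_simps)
  ultimately have "w * w + w + 1 = 0" by simp
  then have "w * w = - 1 - w" by (simp add: eq_diff_eq eq_neg_iff_add_eq_0)
  then show thesis by (rule that)
qed

text \<open>A root would satisfy w^3 = 1. As 3 is prime to the order of the multiplicative group,
  its discrete logarithm is 0, so w = 1 and the polynomial takes the value 3 there.\<close>

lemma no_primitive_cube_root:
  fixes w :: "'a::{field,finite}"
  assumes "CARD('a) mod 3 = 2" "(3::'a) \<noteq> 0"
  shows "w * w + w + 1 \<noteq> 0"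
proof
  assume w: "w * w + w + 1 = 0"
  obtain h :: "'a \<Rightarrow> int" where bij: "bij_betw h (- {0}) {0..<int (CARD('a) - 1)}"
    and mult: "\<And>x y. x \<noteq> 0 \<Longrightarrow> y \<noteq> 0 \<Longrightarrow> h (x * y) = (h x + h y) mod int (CARD('a) - 1)" and h1: "h 1 = 0"
    using nonzero_discrete_log[where 'a = 'a] by blast
  define n where "n = int (CARD('a) - 1)"
  have n: "n mod 3 = 1" using assms(1) unfolding n_def by presburger
  have w0: "w \<noteq> 0" using w by auto
  have ww: "w * w = - 1 - w" using w by (simp add: eq_diff_eq eq_neg_iff_add_eq_0)
  then have "w * w * w = 1" by (simp add: left_diff_distrib)
  then have "(h w + h w + h w) mod n = 0"
    using mult[of "w * w" w] mult[of w w] w0 h1 by (simp add: n_def mod_simps)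
  moreover have hw: "0 \<le> h w" "h w < n" using bij w0 by (auto simp: bij_betw_def n_def)
  ultimately obtain k where k: "3 * h w = n * k" by (auto simp: mod_eq_0_iff_dvd dvd_def)
  have "3 dvd k"
  proof -
    have "coprime 3 n" using n by (metis coprime_mod_right_iff coprime_1_right zero_neq_numeral)
    then show ?thesis using k by (metis coprime_dvd_mult_right_iff dvd_triv_left)
  qed
  then obtain l where "k = 3 * l" by auto
  then have "h w = n * l" using k by simp
  then have "h w = 0" using hw by (metis dvd_triv_left mod_pos_pos_trivial dvd_imp_mod_0)
  then have "w = 1"
    using inj_onD[OF bij_betw_imp_inj_on[OF bij], of w 1] h1 w0 by simp
  then show False using w assms(2) by simp
qed

text \<open>The map evaluates a + b x + c x^2 at the cube roots of unity 1, w and w^2 = -1 - w; its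
  inverse is the discrete Fourier inversion, which divides by 3.\<close>

lemma units_cyc3_split:
  fixes w :: "'a::field"
  assumes w: "w * w = - 1 - w" and three: "(3::'a) \<noteq> 0"
  shows "units_of (cyc3 TYPE('a))
    \<cong> units_of (type_ring TYPE('a)) \<times>\<times> units_of (type_ring TYPE('a)) \<times>\<times> units_of (type_ring TYPE('a))"
proof -
  \<comment> \<open>The companion of w for right-nested products; together they reduce polynomials
    in w to degree at most one.\<close>
  have w': "w * (w * x) = - x - w * x" for x
    using w by (simp add: mult.assoc[symmetric] left_diff_distrib)
  let ?h = "\<lambda>(a, b, c). (a + b + c, a + w * b + (- 1 - w) * c, a + (- 1 - w) * b + w * c)"
  define t :: 'a where "t = inverse 3"
  have t: "t * (3 * x) = x" for x using three by (simp add: t_def)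
  let ?k = "\<lambda>(x, y, z). (t * (x + y + z), t * (x + (- 1 - w) * y + w * z), t * (x + w * y + (- 1 - w) * z))"
  have "bij_betw ?h UNIV UNIV"
  proof (rule bij_betw_byWitness[where f' = ?k], goal_cases)
    case 1
    have "(a + b + c) + (a + w * b + (- 1 - w) * c) + (a + (- 1 - w) * b + w * c) = 3 * a"
      "(a + b + c) + (- 1 - w) * (a + w * b + (- 1 - w) * c) + w * (a + (- 1 - w) * b + w * c) = 3 * b"
      "(a + b + c) + w * (a + w * b + (- 1 - w) * c) + (- 1 - w) * (a + (- 1 - w) * b + w * c) = 3 * c" for a b c
      by (simp_all add: algebra_simps w w')
    note eqs = this
    show ?case
    proof
      fix p :: "'a \<times> 'a \<times> 'a"
      obtain a b c where p: "p = (a, b, c)" by (rule prod_cases3)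
      show "?k (?h p) = p" unfolding p prod.case by (simp only: eqs t)
    qed
  next
    case 2
    have "t * (a + b + c) + t * (a + (- 1 - w) * b + w * c) + t * (a + w * b + (- 1 - w) * c) = t * (3 * a)"
      "t * (a + b + c) + w * (t * (a + (- 1 - w) * b + w * c)) + (- 1 - w) * (t * (a + w * b + (- 1 - w) * c)) = t * (3 * b)"
      "t * (a + b + c) + (- 1 - w) * (t * (a + (- 1 - w) * b + w * c)) + w * (t * (a + w * b + (- 1 - w) * c)) = t * (3 * c)" for a b c
      by (simp_all add: algebra_simps w w')
    note eqs = this
    show ?case
    proof
      fix p :: "'a \<times> 'a \<times> 'a"
      obtain a b c where p: "p = (a, b, c)" by (rule prod_cases3)
      show "?h (?k p) = p" unfolding p prod.case by (simp only: eqs t)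
    qed
  qed auto
  moreover have "?h (x \<otimes>\<^bsub>cyc3 TYPE('a)\<^esub> y) = ?h x \<otimes>\<^bsub>type_ring TYPE('a) \<times>\<times> type_ring TYPE('a) \<times>\<times> type_ring TYPE('a)\<^esub> ?h y" for x y
    by (cases x; cases y) (simp add: cyc3_def type_ring_def algebra_simps w w')
  ultimately have "?h \<in> iso (cyc3 TYPE('a)) (type_ring TYPE('a) \<times>\<times> type_ring TYPE('a) \<times>\<times> type_ring TYPE('a))"
    by (simp add: iso_def hom_def) (simp add: cyc3_def type_ring_def)
  then have "units_of (cyc3 TYPE('a)) \<cong> units_of (type_ring TYPE('a) \<times>\<times> type_ring TYPE('a) \<times>\<times> type_ring TYPE('a))"
    by (rule units_of_iso) (simp_all add: cyc3_def type_ring_def)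
  then show ?thesis by (simp only: units_of_DirProd)
qed

text \<open>
  The pair \<open>(a, b)\<close> stands for \<open>a + b w\<close>, where \<open>w\<^sup>2 = - 1 - w\<close>.
\<close>

definition eisenstein_ring :: "'a::field itself \<Rightarrow> ('a \<times> 'a) ring" where
  "eisenstein_ring ty = \<lparr>carrier = UNIV,
    monoid.mult = (\<lambda>(a, b) (c, d). (a * c - b * d, a * d + b * c - b * d)), one = (1, 0),
    ring.zero = (0, 0), ring.add = (\<lambda>(a, b) (c, d). (a + c, b + d))\<rparr>"

text \<open>The norm a^2 - a b + b^2 of a + b w is, for nonzero b, b^2 times the value of x^2 + x +
  1 at -a/b, hence nonzero. The inverse is the conjugate (a - b) - b w divided by the norm.\<close>

lemma field_eisenstein_ring:
  assumes irred: "\<And>w :: 'a::field. w * w + w + 1 \<noteq> 0"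
  shows "field (eisenstein_ring TYPE('a))"
proof (rule cring.cring_fieldI)
  let ?E = "eisenstein_ring TYPE('a)"
  show "cring ?E"
  proof (rule cringI)
    show "abelian_group ?E"
    proof (rule abelian_groupI)
      fix x assume "x \<in> carrier ?E"
      show "\<exists>y\<in>carrier ?E. y \<oplus>\<^bsub>?E\<^esub> x = \<zero>\<^bsub>?E\<^esub>"
        by (rule bexI[of _ "(- fst x, - snd x)"]) (auto simp: eisenstein_ring_def split: prod.splits)
    qed (auto simp: eisenstein_ring_def)
    show "comm_monoid ?E"
      by (rule comm_monoidI) (auto simp: eisenstein_ring_def algebra_simps)
  qed (auto simp: eisenstein_ring_def algebra_simps)
  have norm: "a * a - a * b + b * b \<noteq> 0" if "(a, b) \<noteq> (0, 0)" for a b :: 'a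
  proof (cases "b = 0")
    case False
    have "a * a - a * b + b * b = b * b * ((- a / b) * (- a / b) + (- a / b) + 1)"
      using False by (simp add: field_simps)
    then show ?thesis using False irred[of "- a / b"] by simp
  qed (use that in simp)
  have "\<exists>c d. (a * c - b * d, a * d + b * c - b * d) = (1, 0)" if "(a, b) \<noteq> (0, 0)" for a b :: 'a
  proof -
    define n where "n = inverse (a * a - a * b + b * b)"
    have "(a * a - a * b + b * b) * n = 1" using norm[OF that] by (simp add: n_def)
    moreover have "a * ((a - b) * n) - b * (- b * n) = (a * a - a * b + b * b) * n"
      "a * (- b * n) + b * ((a - b) * n) - b * (- b * n) = 0"
      by (simp_all add: algebra_simps)
    ultimately have "(a * ((a - b) * n) - b * (- b * n), a * (- b * n) + b * ((a - b) * n) - b * (- b * n)) = (1, 0)"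
      by simp
    then show ?thesis by blast
  qed
  then have "\<exists>y. x \<otimes>\<^bsub>?E\<^esub> y = (1, 0)" if "x \<noteq> (0, 0)" for x
    using that by (cases x) (auto simp: eisenstein_ring_def)
  moreover have "x \<otimes>\<^bsub>?E\<^esub> y = y \<otimes>\<^bsub>?E\<^esub> x" for x y
    by (cases x; cases y) (simp add: eisenstein_ring_def algebra_simps)
  moreover have "carrier ?E = UNIV" "\<one>\<^bsub>?E\<^esub> = (1, 0)" by (simp_all add: eisenstein_ring_def)
  ultimately have "x \<in> Units ?E" if "x \<noteq> (0, 0)" for x
    using that by (simp add: Units_def)
  moreover have "(0, 0) \<notin> Units ?E"
    by (auto simp: Units_def eisenstein_ring_def)
  ultimately have "Units ?E = UNIV - {(0, 0)}" by blast
  then show "Units ?E = carrier ?E - {\<zero>\<^bsub>?E\<^esub>}"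
    by (simp add: eisenstein_ring_def)
qed

text \<open>Chinese remaindering for x^3 - 1 = (x - 1)(x^2 + x + 1), whose factors are coprime as 3
  is invertible. The components are the value at 1 and the residue (a - c) + (b - c) x; the inverse
  recovers c from 3 c = s - x - y.\<close>

lemma units_cyc3_nonsplit:
  assumes three: "(3::'a::field) \<noteq> 0"
  shows "units_of (cyc3 TYPE('a)) \<cong> units_of (type_ring TYPE('a)) \<times>\<times> units_of (eisenstein_ring TYPE('a))"
proof -
  let ?h = "\<lambda>(a::'a, b, c). (a + b + c, a - c, b - c)"
  define t :: 'a where "t = inverse 3"
  have t: "t * (3 * x) = x" for x using three by (simp add: t_def)
  let ?k = "\<lambda>(s, x, y). (x + t * (s - x - y), y + t * (s - x - y), t * (s - x - y))"
  have "bij_betw ?h UNIV UNIV"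
  proof (rule bij_betw_byWitness[where f' = ?k], goal_cases)
    case 1
    have "a + b + c - (a - c) - (b - c) = 3 * c" for a b c :: 'a by simp
    then show ?case by (auto simp: t)
  next
    case 2
    have "x + t * (s - x - y) + (y + t * (s - x - y)) + t * (s - x - y) = x + y + t * (3 * (s - x - y))" for s x y
      by (simp add: algebra_simps)
    then have "x + t * (s - x - y) + (y + t * (s - x - y)) + t * (s - x - y) = s" for s x y
      by (simp only: t) simp
    then show ?case by auto
  qed auto
  moreover have "?h (x \<otimes>\<^bsub>cyc3 TYPE('a)\<^esub> y) = ?h x \<otimes>\<^bsub>type_ring TYPE('a) \<times>\<times> eisenstein_ring TYPE('a)\<^esub> ?h y" for x y
    by (cases x; cases y) (simp add: cyc3_def type_ring_def eisenstein_ring_def algebra_simps)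
  ultimately have "?h \<in> iso (cyc3 TYPE('a)) (type_ring TYPE('a) \<times>\<times> eisenstein_ring TYPE('a))"
    by (simp add: iso_def hom_def) (simp add: cyc3_def type_ring_def eisenstein_ring_def)
  then have "units_of (cyc3 TYPE('a)) \<cong> units_of (type_ring TYPE('a) \<times>\<times> eisenstein_ring TYPE('a))"
    by (rule units_of_iso) (simp_all add: cyc3_def type_ring_def eisenstein_ring_def)
  then show ?thesis by (simp only: units_of_DirProd)
qed

text \<open>
  In characteristic 3, \<open>x\<^sup>3 - 1 = (x - 1)\<^sup>3\<close>, so the substitution \<open>y = x - 1\<close> turns \<open>F[C\<^sub>3]\<close> into \<open>F[y]/(y\<^sup>3)\<close>.
  The triple \<open>(a, b, c)\<close> stands for \<open>a + b y + c y\<^sup>2\<close>, and in \<open>principal_units\<close> the pair \<open>(b, c)\<close>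
  stands for \<open>1 + b y + c y\<^sup>2\<close>.
\<close>

definition truncated_poly :: "'a::field itself \<Rightarrow> ('a \<times> 'a \<times> 'a) monoid" where
  "truncated_poly ty = \<lparr>carrier = UNIV,
     monoid.mult = (\<lambda>(a, b, c) (a', b', c'). (a * a', a * b' + b * a', a * c' + b * b' + c * a')),
     one = (1, 0, 0)\<rparr>"

definition principal_units :: "'a::field itself \<Rightarrow> ('a \<times> 'a) monoid" where
  "principal_units ty = \<lparr>carrier = UNIV,
     monoid.mult = (\<lambda>(b, c) (b', c'). (b + b', c + c' + b * b')), one = (0, 0)\<rparr>"

text \<open>The map expands a + b (1 + y) + c (1 + y)^2 in powers of y.\<close>

lemma units_cyc3_truncated_poly:
  assumes three: "(3::'a::field) = 0"
  shows "units_of (cyc3 TYPE('a)) \<cong> units_of (truncated_poly TYPE('a))"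
proof -
  let ?h = "\<lambda>(a::'a, b, c). (a + b + c, b + 2 * c, c)"
  let ?k = "\<lambda>(a::'a, b, c). (a - b + c, b - 2 * c, c)"
  have "bij_betw ?h UNIV UNIV"
    by (rule bij_betw_byWitness[where f' = ?k]) auto
  moreover have "?h (x \<otimes>\<^bsub>cyc3 TYPE('a)\<^esub> y) = ?h x \<otimes>\<^bsub>truncated_poly TYPE('a)\<^esub> ?h y" for x y
  proof -
    obtain a b c a' b' c' where xy: "x = (a, b, c)" "y = (a', b', c')" by (metis prod.exhaust)
    \<comment> \<open>The two multiplications differ by multiples of 3, isolated here so that
      \<open>three\<close> removes them.\<close>
    have "(a + b + c) * (b' + 2 * c') + (b + 2 * c) * (a' + b' + c')
        = (a * b' + b * a' + c * c') + 2 * (a * c' + b * b' + c * a') + 3 * (b * c' + c * b' + c * c')"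
      "(a + b + c) * c' + (b + 2 * c) * (b' + 2 * c') + c * (a' + b' + c')
        = (a * c' + b * b' + c * a') + 3 * (b * c' + c * b' + 2 * c * c')"
      "(a + b + c) * (a' + b' + c') = (a * a' + b * c' + c * b') + (a * b' + b * a' + c * c') + (a * c' + b * b' + c * a')"
      by (simp_all add: algebra_simps)
    then show ?thesis unfolding xy cyc3_def truncated_poly_def three
      by (simp del: distrib_left_numeral)
  qed
  ultimately have "?h \<in> iso (cyc3 TYPE('a)) (truncated_poly TYPE('a))"
    by (simp add: iso_def hom_def) (simp add: cyc3_def truncated_poly_def)
  then show ?thesis
    by (rule units_of_iso) (simp_all add: cyc3_def truncated_poly_def)
qed

lemma Units_truncated_poly: "x \<in> Units (truncated_poly TYPE('a::field)) \<longleftrightarrow> fst x \<noteq> 0"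
proof -
  obtain a b c where x: "x = (a, b, c)" by (metis prod.exhaust)
  have "\<exists>y. y \<otimes>\<^bsub>truncated_poly TYPE('a)\<^esub> x = (1, 0, 0) \<and> x \<otimes>\<^bsub>truncated_poly TYPE('a)\<^esub> y = (1, 0, 0)" if "a \<noteq> 0"
    \<comment> \<open>The coefficients of 1 / (a + b y + c y^2), expanded up to y^2.\<close>
    using that by (intro exI[of _ "(1 / a, - b / (a * a), (b * b / a - c) / (a * a))"])
      (simp add: x truncated_poly_def field_simps)
  then show ?thesis
    by (auto simp: Units_def truncated_poly_def x)
qed

text \<open>A unit is its nonzero constant term times a polynomial with constant term 1.\<close>

lemma units_truncated_poly_iso:
  "units_of (truncated_poly TYPE('a::field)) \<cong> units_of (type_ring TYPE('a)) \<times>\<times> principal_units TYPE('a)"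
proof -
  let ?h = "\<lambda>(a::'a, b, c). (a, b / a, c / a)"
  let ?k = "\<lambda>(a::'a, b, c). (a, a * b, a * c)"
  have "bij_betw ?h (carrier (units_of (truncated_poly TYPE('a)))) (carrier (units_of (type_ring TYPE('a)) \<times>\<times> principal_units TYPE('a)))"
    by (rule bij_betw_byWitness[where f' = ?k])
       (auto simp: units_of_carrier Units_truncated_poly Units_type_ring principal_units_def)
  moreover have "?h \<in> hom (units_of (truncated_poly TYPE('a))) (units_of (type_ring TYPE('a)) \<times>\<times> principal_units TYPE('a))"
  proof (rule homI)
    fix x y assume "x \<in> carrier (units_of (truncated_poly TYPE('a)))" "y \<in> carrier (units_of (truncated_poly TYPE('a)))"
    then have "fst x \<noteq> 0" "fst y \<noteq> 0" by (simp_all add: units_of_carrier Units_truncated_poly)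
    then show "?h (x \<otimes>\<^bsub>units_of (truncated_poly TYPE('a))\<^esub> y)
        = ?h x \<otimes>\<^bsub>units_of (type_ring TYPE('a)) \<times>\<times> principal_units TYPE('a)\<^esub> ?h y"
      unfolding units_of_def
      by (cases x; cases y) (simp add: principal_units_def truncated_poly_def type_ring_def field_simps)
  qed (auto simp: units_of_carrier Units_truncated_poly Units_type_ring principal_units_def)
  ultimately show ?thesis by (intro is_isoI[of ?h]) (simp add: iso_def)
qed

lemma comm_group_principal_units: "comm_group (principal_units TYPE('a::field))"
proof (rule comm_groupI)
  fix x assume "x \<in> carrier (principal_units TYPE('a))"
  show "\<exists>y\<in>carrier (principal_units TYPE('a)). y \<otimes>\<^bsub>principal_units TYPE('a)\<^esub> x = \<one>\<^bsub>principal_units TYPE('a)\<^esub>"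
    by (rule bexI[of _ "(- fst x, fst x * fst x - snd x)"]) (auto simp: principal_units_def split: prod.splits)
qed (auto simp: principal_units_def algebra_simps)

text \<open>In characteristic 3, (1 + u)^3 = 1 + u^3, and u^3 = 0 when y divides u, so every element
  has trivial cube. Two copies have q^4 = 3^(4k) elements, which fixes the rank.\<close>

lemma principal_units_square_iso:
  assumes three: "(3::'a::{field,finite}) = 0" and card: "CARD('a) = 3 ^ k"
  shows "principal_units TYPE('a) \<times>\<times> principal_units TYPE('a) \<cong> group_power (integer_mod_group 3) (4 * k)"
proof -
  let ?P = "principal_units TYPE('a)"
  interpret P: comm_group ?P by (rule comm_group_principal_units)
  interpret PP: group "?P \<times>\<times> ?P" by (intro DirProd_group P.is_group)
  interpret PP: comm_group "?P \<times>\<times> ?P"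
    by (rule PP.group_comm_groupI) (auto simp: P.m_comm)
  have cube: "x \<otimes>\<^bsub>?P\<^esub> x \<otimes>\<^bsub>?P\<^esub> x = \<one>\<^bsub>?P\<^esub>" for x
  proof -
    obtain b c where x: "x = (b, c)" by (cases x)
    have "b + b + b = 0" "c + c + b * b + c + (b + b) * b = 0"
    proof -
      have "b + b + b = 3 * b" "c + c + b * b + c + (b + b) * b = 3 * (c + b * b)"
        by (simp_all add: algebra_simps)
      then show "b + b + b = 0" "c + c + b * b + c + (b + b) * b = 0"
        unfolding three by simp_all
    qed
    then show ?thesis by (simp add: x principal_units_def)
  qed
  show ?thesis
  proof (rule PP.elementary_abelian_iso)
    show "Factorial_Ring.prime (3::nat)" by simp
    show "x [^]\<^bsub>?P \<times>\<times> ?P\<^esub> (3::nat) = \<one>\<^bsub>?P \<times>\<times> ?P\<^esub>" if "x \<in> carrier (?P \<times>\<times> ?P)" for x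
    proof -
      obtain y z where x: "x = (y, z)" by (cases x)
      then have "y \<in> carrier ?P" "z \<in> carrier ?P" using that by auto
      then show ?thesis using cube by (simp add: x numeral_eq_Suc)
    qed
    have "order (?P \<times>\<times> ?P) = CARD('a) ^ 4"
      by (simp add: order_def principal_units_def card_cartesian_product eval_nat_numeral del: UNIV_Times_UNIV flip: UNIV_Times_UNIV)
    then show "order (?P \<times>\<times> ?P) = 3 ^ (4 * k)" by (simp add: card power_mult[symmetric] mult.commute)
  qed
qed

section \<open>The unit group of \<open>F[C\<^sub>2 \<times> A\<^sub>4]\<close>\<close>

theorem theorem2p4:
  fixes p k q :: nat
    and G :: "(int \<times> (nat \<Rightarrow> nat)) monoid"
  assumes "CHAR('a::{field,finite}) = p"
    and "CARD('a) = q"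
    and "q = p ^ k"
    and "G = integer_mod_group 2 \<times>\<times> alt_group 4"
  shows "(p = 3 \<longrightarrow>
      (\<exists>\<phi> \<in> hom (group_power (integer_mod_group (3 ^ k - 1)) 2 \<times>\<times> group_power (GL 3 TYPE('a)) 2)
                (AutoGroup (group_power (integer_mod_group 3) (4 * k))).
         units_of (group_algebra TYPE('a) G) \<cong>
           semidirect_product
             (group_power (integer_mod_group 3) (4 * k))
             (group_power (integer_mod_group (3 ^ k - 1)) 2 \<times>\<times> group_power (GL 3 TYPE('a)) 2)
             \<phi>))
    \<and> (p > 3 \<longrightarrow>
      ([int q = 1] (mod 6) \<longrightarrow>
         units_of (group_algebra TYPE('a) G) \<cong>
           group_power (integer_mod_group (p ^ k - 1)) 6 \<times>\<times> group_power (GL 3 TYPE('a)) 2)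
      \<and> ([int q = - 1] (mod 6) \<longrightarrow>
         units_of (group_algebra TYPE('a) G) \<cong>
           group_power (integer_mod_group (p ^ k - 1)) 2
             \<times>\<times> group_power (integer_mod_group (p ^ (2 * k) - 1)) 2
             \<times>\<times> group_power (GL 3 TYPE('a)) 2))"
proof -
  let ?T = "type_ring TYPE('a)" and ?GL = "group_power (GL 3 TYPE('a)) 2"
  let ?U = "units_of (cyc3 TYPE('a))"
  have q: "CARD('a) = p ^ k" using assms by simp
  have char: "of_nat n = (0::'a) \<longleftrightarrow> p dvd n" for n
    using assms(1) of_nat_eq_0_iff_char_dvd[where 'a = 'a] by simp
  \<comment> \<open>A characteristic of at least 3 does not divide 2, so 8 = 2 * 2 * 2 is invertible
    and the transform can be inverted.\<close>
  have eight: "(8::'a) \<noteq> 0" if "p \<ge> 3"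
  proof -
    have "of_nat 2 \<noteq> (0::'a)" unfolding char using that by (auto dest: dvd_imp_le)
    then have "(2::'a) \<noteq> 0" by simp
    moreover have "(8::'a) = 2 * 2 * 2" by simp
    ultimately show ?thesis by (metis mult_eq_0_iff)
  qed
  have main: "units_of (group_algebra TYPE('a) G) \<cong> (?U \<times>\<times> ?U) \<times>\<times> ?GL" if "p \<ge> 3"
    unfolding assms(4) using eight[OF that] by (rule units_group_algebra_iso)
  have T: "units_of ?T \<cong> integer_mod_group (p ^ k - 1)"
    using units_type_ring_iso[where 'a = 'a] by (simp add: q)
  show ?thesis
  proof (intro conjI impI)
    assume p: "p = 3"
    let ?N = "group_power (integer_mod_group 3) (4 * k)" and ?P = "principal_units TYPE('a)"
    let ?H = "group_power (integer_mod_group (3 ^ k - 1)) 2 \<times>\<times> ?GL"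
    have three: "(3::'a) = 0" using char[of 3] p by simp
    have "?U \<cong> units_of (truncated_poly TYPE('a))" using three by (rule units_cyc3_truncated_poly)
    also have "\<dots> \<cong> units_of ?T \<times>\<times> ?P" by (rule units_truncated_poly_iso)
    also have "\<dots> \<cong> integer_mod_group (3 ^ k - 1) \<times>\<times> ?P"
      using T by (intro DirProd_is_iso_cong iso_refl) (simp add: p)
    also have "\<dots> \<cong> ?P \<times>\<times> integer_mod_group (3 ^ k - 1)" by (rule DirProd_commute_iso)
    finally have U: "?U \<cong> ?P \<times>\<times> integer_mod_group (3 ^ k - 1)" .
    have "?U \<times>\<times> ?U \<cong> (?P \<times>\<times> integer_mod_group (3 ^ k - 1)) \<times>\<times> (?P \<times>\<times> integer_mod_group (3 ^ k - 1))"
      using U by (intro DirProd_is_iso_cong)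
    \<comment> \<open>Regrouping collects the principal units into the normal factor and the cyclic
      groups into the complement.\<close>
    also have "\<dots> \<cong> (?P \<times>\<times> ?P) \<times>\<times> (integer_mod_group (3 ^ k - 1) \<times>\<times> integer_mod_group (3 ^ k - 1))"
      by (rule DirProd_swap_middle_iso)
    also have "\<dots> \<cong> ?N \<times>\<times> group_power (integer_mod_group (3 ^ k - 1)) 2"
      using three q p by (intro DirProd_is_iso_cong principal_units_square_iso group_power_2_iso) simp_all
    finally have UU: "?U \<times>\<times> ?U \<cong> ?N \<times>\<times> group_power (integer_mod_group (3 ^ k - 1)) 2" .
    have "units_of (group_algebra TYPE('a) G) \<cong> (?U \<times>\<times> ?U) \<times>\<times> ?GL" using main p by simp
    also have "\<dots> \<cong> (?N \<times>\<times> group_power (integer_mod_group (3 ^ k - 1)) 2) \<times>\<times> ?GL"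
      by (intro DirProd_is_iso_cong UU iso_refl)
    also have "\<dots> \<cong> ?N \<times>\<times> ?H" by (rule DirProd_assoc_is_iso)
    also have "\<dots> \<cong> semidirect_product ?N ?H (\<lambda>_. \<lambda>x\<in>carrier ?N. x)"
      by (rule semidirect_product_trivial_iso)
    finally have iso: "units_of (group_algebra TYPE('a) G) \<cong> semidirect_product ?N ?H (\<lambda>_. \<lambda>x\<in>carrier ?N. x)" .
    have "group ?N" by (simp add: group_power_def)
    then show "\<exists>\<phi> \<in> hom ?H (AutoGroup ?N). units_of (group_algebra TYPE('a) G) \<cong> semidirect_product ?N ?H \<phi>"
      using iso by (intro bexI[of _ "\<lambda>_. \<lambda>x\<in>carrier ?N. x"] trivial_action_hom)
  next
    assume p: "p > 3" and q1: "[int q = 1] (mod 6)"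
    have three: "(3::'a) \<noteq> 0" using char[of 3] p by (auto dest: dvd_imp_le)
    \<comment> \<open>Reducing further modulo 3 shows that the field contains a primitive cube root
      of unity.\<close>
    have "int (q mod 6) = int 1" using q1 by (simp add: cong_def zmod_int)
    then have "CARD('a) mod 3 = 1" unfolding assms(2) of_nat_eq_iff by presburger
    then obtain w :: 'a where "w * w = - 1 - w" by (rule primitive_cube_root_exists)
    then have "?U \<cong> units_of ?T \<times>\<times> units_of ?T \<times>\<times> units_of ?T"
      using three by (rule units_cyc3_split)
    then have "?U \<times>\<times> ?U \<cong> (units_of ?T \<times>\<times> units_of ?T \<times>\<times> units_of ?T) \<times>\<times> (units_of ?T \<times>\<times> units_of ?T \<times>\<times> units_of ?T)"
      by (intro DirProd_is_iso_cong)
    also have "\<dots> \<cong> (integer_mod_group (p ^ k - 1) \<times>\<times> integer_mod_group (p ^ k - 1) \<times>\<times> integer_mod_group (p ^ k - 1))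
        \<times>\<times> (integer_mod_group (p ^ k - 1) \<times>\<times> integer_mod_group (p ^ k - 1) \<times>\<times> integer_mod_group (p ^ k - 1))"
      by (intro DirProd_is_iso_cong T)
    also have "\<dots> \<cong> group_power (integer_mod_group (p ^ k - 1)) 6" by (rule group_power_6_iso)
    finally have UU: "?U \<times>\<times> ?U \<cong> group_power (integer_mod_group (p ^ k - 1)) 6" .
    have "units_of (group_algebra TYPE('a) G) \<cong> (?U \<times>\<times> ?U) \<times>\<times> ?GL" using main p by simp
    also have "\<dots> \<cong> group_power (integer_mod_group (p ^ k - 1)) 6 \<times>\<times> ?GL"
      by (intro DirProd_is_iso_cong UU iso_refl)
    finally show "units_of (group_algebra TYPE('a) G) \<cong> group_power (integer_mod_group (p ^ k - 1)) 6 \<times>\<times> ?GL" .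
  next
    assume p: "p > 3" and q2: "[int q = - 1] (mod 6)"
    let ?E = "eisenstein_ring TYPE('a)"
    let ?A = "integer_mod_group (p ^ k - 1)" and ?B = "integer_mod_group (p ^ (2 * k) - 1)"
    have three: "(3::'a) \<noteq> 0" using char[of 3] p by (auto dest: dvd_imp_le)
    \<comment> \<open>The representative of -1 modulo 6 is 5, which leaves 2 modulo 3, so x^2 + x +
      1 has no root.\<close>
    have "int (q mod 6) = int 5" using q2 by (simp add: cong_def zmod_int)
    then have "CARD('a) mod 3 = 2" unfolding assms(2) of_nat_eq_iff by presburger
    then have "field ?E" using three no_primitive_cube_root by (intro field_eisenstein_ring) blast
    \<comment> \<open>The quadratic extension has q^2 elements, which is the source of the exponent
      2k.\<close>
    moreover have "order ?E = p ^ (2 * k)"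
      by (simp add: order_def eisenstein_ring_def card_cartesian_product q mult_2 power_add del: UNIV_Times_UNIV flip: UNIV_Times_UNIV)
    ultimately have E: "units_of ?E \<cong> ?B"
      using field.finite_units_iso[of ?E] by (simp add: eisenstein_ring_def)
    have "?U \<cong> units_of ?T \<times>\<times> units_of ?E" using three by (rule units_cyc3_nonsplit)
    also have "\<dots> \<cong> ?A \<times>\<times> ?B" by (intro DirProd_is_iso_cong T E)
    finally have U: "?U \<cong> ?A \<times>\<times> ?B" .
    have "?U \<times>\<times> ?U \<cong> (?A \<times>\<times> ?B) \<times>\<times> (?A \<times>\<times> ?B)" by (intro DirProd_is_iso_cong U)
    also have "\<dots> \<cong> (?A \<times>\<times> ?A) \<times>\<times> (?B \<times>\<times> ?B)" by (rule DirProd_swap_middle_iso)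
    also have "\<dots> \<cong> group_power ?A 2 \<times>\<times> group_power ?B 2"
      by (intro DirProd_is_iso_cong group_power_2_iso)
    finally have UU: "?U \<times>\<times> ?U \<cong> group_power ?A 2 \<times>\<times> group_power ?B 2" .
    have "units_of (group_algebra TYPE('a) G) \<cong> (?U \<times>\<times> ?U) \<times>\<times> ?GL" using main p by simp
    also have "\<dots> \<cong> (group_power ?A 2 \<times>\<times> group_power ?B 2) \<times>\<times> ?GL"
      by (intro DirProd_is_iso_cong UU iso_refl)
    also have "\<dots> \<cong> group_power ?A 2 \<times>\<times> group_power ?B 2 \<times>\<times> ?GL"
      by (rule DirProd_assoc_is_iso)
    finally show "units_of (group_algebra TYPE('a) G) \<cong> group_power ?A 2 \<times>\<times> group_power ?B 2 \<times>\<times> ?GL" .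
  qed
qed

end
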